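(* We have $S(\sqrt2;N)\ll N^{5/6}(\log N)^{13/2}$ for $N\ge2$.
   Context: $\mathfrak{B}$ is the set of odd positive integers that are sums of two coprime squares (equivalently, odd positive integers with no prime factor $\equiv3\pmod4$), $b$ its characteristic function, $e(x)=e^{2\pi ix}$ and $S(\alpha;N)=\sum_{n\le N}b(n)e(n\alpha)$. *)

theory Defs
  imports "HOL-Analysis.Analysis" "HOL-Number_Theory.Number_Theory"
begin

definition frakB :: "nat set" where
  "frakB = {n. odd n \<and> (\<exists>x y :: int. coprime x y \<and> int n = x\<^sup>2 + y\<^sup>2)}"

definition bchar :: "nat \<Rightarrow> complex" where
  "bchar n = indicator frakB n"

definition expi :: "real \<Rightarrow> complex" where
  "expi x = exp (2 * of_real pi * \<i> * of_real x)"

definition expsum :: "real \<Rightarrow> real \<Rightarrow> complex" where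
  "expsum \<alpha> N = (\<Sum>n | 1 \<le> n \<and> real n \<le> N. bchar n * expi (real n * \<alpha>))"

end

theory Submission
  imports Defs "HOL-Computational_Algebra.Squarefree"
begin

text \<open>
  An integer \<open>n \<equiv> 1 (mod 4)\<close> with \<open>n \<le> N\<close> lies in \<open>frakB\<close> iff no prime
  \<open>p \<equiv> 3 (mod 4)\<close> with \<open>p \<le> \<surd>N\<close> divides it, because the number of such prime factors,
  counted with multiplicity, is even. Put \<open>y = N\<^bsup>1/3\<^esup>\<close>. Buchstab's identity, iterated until the
  sieving divisor \<open>d\<close> exceeds \<open>y\<close>, leaves divisors \<open>d \<le> y\<close>, for which the sums over
  multiples of \<open>d\<close> are geometric, and boundary divisors \<open>y < d \<le> y\<^sup>2\<close>, for which the cofactor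
  \<open>k\<close> is only required to have no prime factor \<open>\<equiv> 3 (mod 4)\<close> below the least prime of \<open>d\<close>.
  Binary digits separate this last condition at the cost of one logarithm, and Cauchy's inequality
  over \<open>k\<close> bounds the resulting bilinear sums, since the points \<open>d\<surd>2\<close> with \<open>D \<le> d < 2D\<close> are
  spaced by at least \<open>1/(4D)\<close> modulo 1. With \<open>D\<close> between \<open>N\<^bsup>1/3\<^esup>\<close> and \<open>N\<^bsup>2/3\<^esup>\<close> every
  dyadic block is \<open>O(N\<^bsup>5/6\<^esup>(log N)\<^bsup>3/2\<^esup>)\<close>, which even gives the exponent \<open>5/2\<close> of the logarithm.
\<close>

subsection \<open>Sums of two coprime squares\<close>

lemma QuadRes_minus_one_prime:
  assumes "prime p" "p mod 4 = 1"
  shows "\<exists>s. int p dvd s\<^sup>2 + 1"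
proof -
  have p2: "p > 2" using assms prime_gt_1_nat[of p] by (cases "p = 2") auto
  have "even ((p - 1) div 2)" using assms by presburger
  then have "[Legendre (-1) p = 1] (mod p)"
    using euler_criterion[OF assms(1) p2, of "-1"] by simp
  have "Legendre (-1) p \<noteq> -1"
  proof
    assume "Legendre (-1) p = -1"
    with \<open>[Legendre (-1) p = 1] (mod p)\<close> have "int p dvd -1 - 1"
      by (simp add: cong_iff_dvd_diff)
    then have "int p dvd 2" by simp
    then show False using p2 zdvd_imp_le[of "int p" 2] by simp
  qed
  moreover have "\<not> [-1 = 0] (mod int p)"
    using p2 by (simp add: cong_0_iff)
  ultimately have "QuadRes p (-1)"
    unfolding Legendre_def by (auto split: if_splits)
  then show ?thesis
    by (auto simp: QuadRes_def cong_iff_dvd_diff)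
qed

text \<open>A Hensel lift when \<open>p\<close> divides \<open>m\<close>, the Chinese remainder
  theorem otherwise. The lift needs \<open>2 * s\<close> invertible modulo \<open>p\<close>, which
  holds because \<open>p\<close> is odd and divides s^2 + 1.\<close>

lemma sqrt_minus_one_mult_prime:
  fixes m s t p :: int
  assumes p: "prime p" "odd p" and m: "m dvd s\<^sup>2 + 1" and t: "p dvd t\<^sup>2 + 1"
  shows "\<exists>r. p * m dvd r\<^sup>2 + 1"
proof (cases "p dvd m")
  case True
  obtain k where k: "s\<^sup>2 + 1 = m * k" using m by blast
  have "\<not> p dvd 2 * s"
  proof
    assume "p dvd 2 * s"
    moreover have "\<not> p dvd 2"
      using p primes_dvd_imp_eq[of p 2] by auto
    ultimately have "p dvd s" using p(1) prime_dvd_mult_iff by blast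
    then have "p dvd s\<^sup>2" by (simp add: power2_eq_square)
    moreover have "p dvd s\<^sup>2 + 1" using True m by (rule dvd_trans)
    ultimately have "p dvd 1" using dvd_add_right_iff by blast
    then show False using p(1) not_prime_unit by blast
  qed
  then have "coprime (2 * s) p"
    using p(1) prime_imp_coprime coprime_commute by blast
  then obtain i where i: "[2 * s * i = 1] (mod p)"
    using cong_solve_coprime_int by blast
  \<comment> \<open>The shift is chosen so that its linear contribution 2 s m (-k i) cancels s^2 + 1
    = m k modulo p m, as \<open>i\<close> inverts \<open>2 * s\<close>. The quadratic contribution
    carries m^2 and is harmless.\<close>
  define r where "r = s + m * (- k * i)"
  have "r\<^sup>2 + 1 = (s\<^sup>2 + 1) - 2 * s * m * k * i + m * m * (k * i)\<^sup>2"
    by (simp add: r_def power2_eq_square algebra_simps)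
  also have "\<dots> = m * (k * (1 - 2 * s * i) + m * (k * i)\<^sup>2)"
    unfolding k by (simp add: algebra_simps)
  finally have r: "r\<^sup>2 + 1 = m * (k * (1 - 2 * s * i) + m * (k * i)\<^sup>2)" .
  have "p dvd 1 - 2 * s * i"
    using i by (simp add: cong_iff_dvd_diff dvd_diff_commute)
  then have "p dvd k * (1 - 2 * s * i) + m * (k * i)\<^sup>2"
    using True by (intro dvd_add dvd_mult dvd_mult2) auto
  then have "p * m dvd r\<^sup>2 + 1"
    unfolding r by (subst mult.commute) (rule mult_dvd_mono, auto)
  then show ?thesis ..
next
  case False
  then have cop: "coprime p m" using p(1) prime_imp_coprime by blast
  then obtain r where r: "[r = t] (mod p)" "[r = s] (mod m)"
    using binary_chinese_remainder_int by blast
  have "[r\<^sup>2 + 1 = t\<^sup>2 + 1] (mod p)" "[r\<^sup>2 + 1 = s\<^sup>2 + 1] (mod m)"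
    using r by (auto intro: cong_add cong_pow)
  then have "p dvd r\<^sup>2 + 1" "m dvd r\<^sup>2 + 1"
    using m t cong_dvd_iff by blast+
  then show ?thesis using cop divides_mult by blast
qed

lemma sqrt_minus_one_mod:
  fixes n :: nat
  assumes "n > 0" "\<And>p. prime p \<Longrightarrow> p dvd n \<Longrightarrow> p mod 4 = 1"
  shows "\<exists>s. int n dvd s\<^sup>2 + 1"
  using assms
proof (induction n rule: prime_divisors_induct)
  case (factor p x)
  obtain t where t: "int p dvd t\<^sup>2 + 1"
    using QuadRes_minus_one_prime[of p] factor by auto
  obtain s where s: "int x dvd s\<^sup>2 + 1"
    using factor by auto
  have "odd p" using factor.prems(2)[of p] factor.hyps by (auto, presburger)
  then show ?case
    using sqrt_minus_one_mult_prime[of "int p" "int x" s t] s t factor.hyps by auto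
qed auto

text \<open>Thue's pigeonhole argument: among the more than \<open>n\<close> values \<open>a - s b\<close> with
  \<open>0 \<le> a, b \<le> \<lfloor>\<surd>n\<rfloor>\<close>, two agree modulo \<open>n\<close>.\<close>

lemma thue_two_squares:
  fixes n :: nat and s :: int
  assumes n: "n > 1" "odd n" and s: "int n dvd s\<^sup>2 + 1"
  shows "\<exists>x y t :: int. x = s * y + int n * t \<and> x\<^sup>2 + y\<^sup>2 = int n"
proof -
  define k where "k = nat \<lfloor>sqrt n\<rfloor>"
  have k_le: "real k \<le> sqrt n" "sqrt n < real k + 1"
    unfolding k_def by (simp_all add: of_nat_nat)
  have "(real k)\<^sup>2 \<le> (sqrt n)\<^sup>2" using k_le by (intro power_mono) auto
  then have "real (k\<^sup>2) \<le> real n" by simp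
  then have kn: "k\<^sup>2 \<le> n" by (simp only: of_nat_le_iff)
  have "(sqrt n)\<^sup>2 < (real k + 1)\<^sup>2" using k_le by (intro power_strict_mono) auto
  then have "real n < real ((k + 1)\<^sup>2)" by (simp add: add.commute)
  then have nk: "n < (k + 1)\<^sup>2" by (simp only: of_nat_less_iff)
  define f where "f = (\<lambda>(a, b). (int a - s * int b) mod int n)"
  have "\<not> inj_on f ({0..k} \<times> {0..k})"
  proof
    assume "inj_on f ({0..k} \<times> {0..k})"
    moreover have "f ` ({0..k} \<times> {0..k}) \<subseteq> {0..<int n}"
      using n by (auto simp: f_def)
    ultimately have "card ({0..k} \<times> {0..k}) \<le> card {0..<int n}"
      by (intro card_inj_on_le) auto
    then show False using nk by (simp add: card_cartesian_product power2_eq_square)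
  qed
  then obtain a b a' b' where ab: "a \<le> k" "b \<le> k" "a' \<le> k" "b' \<le> k" "(a, b) \<noteq> (a', b')"
    "f (a, b) = f (a', b')"
    by (auto simp: inj_on_def)
  define x y where "x = int a - int a'" and "y = int b - int b'"
  have "int n dvd (int a - s * int b) - (int a' - s * int b')"
    using ab(6) by (simp add: f_def mod_eq_dvd_iff)
  then obtain t where "(int a - s * int b) - (int a' - s * int b') = int n * t" by blast
  then have t: "x = s * y + int n * t"
    by (simp add: x_def y_def algebra_simps)
  obtain m where m: "s\<^sup>2 + 1 = int n * m" using s by blast
  \<comment> \<open>The quotient (x^2 + y^2)/n, expanded so that every common divisor of
    \<open>y\<close> and \<open>n\<close> visibly divides it. This is what rules out the value 2
    below.\<close>
  define q where "q = y * (m * y + 2 * s * t) + int n * t\<^sup>2"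
  have "x\<^sup>2 + y\<^sup>2 = (s\<^sup>2 + 1) * y\<^sup>2 + int n * (2 * s * y * t + int n * t\<^sup>2)"
    unfolding t by (simp add: power2_eq_square algebra_simps)
  also have "\<dots> = int n * q"
    unfolding m q_def by (simp add: power2_eq_square algebra_simps)
  finally have q: "x\<^sup>2 + y\<^sup>2 = int n * q" .
  have abs: "\<bar>x\<bar> \<le> int k" "\<bar>y\<bar> \<le> int k" using ab by (auto simp: x_def y_def)
  then have sq: "x\<^sup>2 \<le> (int k)\<^sup>2" "y\<^sup>2 \<le> (int k)\<^sup>2"
    by (simp_all add: abs_le_square_iff[symmetric])
  have kn': "(int k)\<^sup>2 \<le> int n" using kn by (simp only: of_nat_power[symmetric] of_nat_le_iff)
  have "x \<noteq> 0 \<or> y \<noteq> 0" using ab(5) by (auto simp: x_def y_def)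
  then have "0 < x\<^sup>2 + y\<^sup>2" by (simp add: sum_power2_gt_zero_iff)
  then have "0 < q" using q n by (simp add: zero_less_mult_iff)
  have "int n * q \<le> int n * 2" using sq kn' q by linarith
  then have "q \<le> 2" using n by simp
  \<comment> \<open>The value 2 forces y^2 = k^2 = n, so \<open>k\<close> divides both
    \<open>y\<close> and \<open>n\<close>, hence q = 2. Then \<open>n\<close> is 1 or 4, against n >
    1 odd.\<close>
  have "q \<noteq> 2"
  proof
    assume q2: "q = 2"
    then have eq: "x\<^sup>2 = (int k)\<^sup>2" "y\<^sup>2 = (int k)\<^sup>2" "(int k)\<^sup>2 = int n"
      using sq kn' q[unfolded q2] by linarith+
    have "int k dvd y" using eq(2) by (simp add: power2_eq_iff) auto
    moreover have "int k dvd int n" using eq(3) by (metis dvd_triv_left power2_eq_square)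
    ultimately have "int k dvd q" unfolding q_def by (intro dvd_add dvd_mult2)
    then have "k dvd 2" using q2 by (metis of_nat_dvd_iff of_nat_numeral)
    then have "k = 1 \<or> k = 2" using two_is_prime_nat prime_nat_iff by blast
    moreover have "k\<^sup>2 = n" using eq(3) by (metis of_nat_eq_iff of_nat_power)
    ultimately show False using n by auto
  qed
  then have "q = 1" using \<open>0 < q\<close> \<open>q \<le> 2\<close> by linarith
  then show ?thesis using t q by auto
qed

section \<open>Prime divisors congruent to 3 modulo 4\<close>

definition prime3 :: "nat \<Rightarrow> bool" where
  "prime3 p \<longleftrightarrow> prime p \<and> p mod 4 = 3"

text \<open>A prime dividing the sum and one of \<open>x\<close>, \<open>y\<close> would divide
  both, so Fermat's theorem applies to each. Since (p - 1)/2 is odd, raising x^2 = -y^2 to that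
  power gives 1 = -1 modulo \<open>p\<close>.\<close>

lemma not_prime3_dvd_sum_squares:
  fixes x y :: int
  assumes "prime3 p" "coprime x y"
  shows "\<not> int p dvd x\<^sup>2 + y\<^sup>2"
proof
  assume dvd: "int p dvd x\<^sup>2 + y\<^sup>2"
  have p: "prime p" "p mod 4 = 3" using assms by (auto simp: prime3_def)
  have *: False if "int p dvd a" "int p dvd a\<^sup>2 + b\<^sup>2" "coprime a b" for a b :: int
  proof -
    have "int p dvd b\<^sup>2"
      using that(1,2) dvd_add_right_iff[of "int p" "a\<^sup>2" "b\<^sup>2"] by (simp add: power2_eq_square)
    then have "int p dvd b" using p prime_dvd_power by (metis prime_nat_int_transfer)
    with that have "int p dvd 1" using coprime_common_divisor by blast
    then show False using p(1) by simp
  qed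
  have "\<not> int p dvd x" using *[of x y] dvd assms by blast
  moreover have "\<not> int p dvd y"
    using *[of y x] dvd assms by (auto simp: coprime_commute add.commute)
  moreover define h where "h = (p - 1) div 2"
  have h: "odd h" "p - 1 = 2 * h" unfolding h_def using p(2) by presburger+
  have fermat: "[a ^ (p - 1) = 1] (mod p)" if "\<not> int p dvd a" for a :: int
  proof -
    \<comment> \<open>Fermat's theorem is applied to the natural number |a|; the exponent p - 1 is
      even, so the absolute value disappears.\<close>
    have "\<not> p dvd nat \<bar>a\<bar>" using that by (simp add: nat_dvd_iff int_dvd_int_iff[symmetric])
    then have "[int (nat \<bar>a\<bar> ^ (p - 1)) = int 1] (mod p)"
      using fermat_theorem[OF p(1)] by (simp only: cong_int_iff)
    then show ?thesis using h(2) by (simp add: power_even_abs)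
  qed
  ultimately have f: "[x ^ (p - 1) = 1] (mod p)" "[y ^ (p - 1) = 1] (mod p)"
    by blast+
  have "[x\<^sup>2 = - y\<^sup>2] (mod p)" using dvd by (simp add: cong_iff_dvd_diff)
  then have "[(x\<^sup>2) ^ h = (- y\<^sup>2) ^ h] (mod p)" by (rule cong_pow)
  then have "[x ^ (p - 1) = - (y ^ (p - 1))] (mod p)"
    using h by (simp add: power_mult power_minus_odd)
  moreover have "[- (y ^ (p - 1)) = - 1] (mod p)"
    using f(2) by (simp add: cong_minus_minus_iff)
  ultimately have "[1 = - 1] (mod int p)"
    using f(1) cong_trans cong_sym by blast
  then have "int p dvd 2" by (simp add: cong_iff_dvd_diff)
  then have "p dvd 2" by (metis of_nat_dvd_iff of_nat_numeral)
  then have "p \<le> 2" by (simp add: dvd_imp_le)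
  then show False using p by (auto simp: le_Suc_eq numeral_2_eq_2)
qed

lemma ex_prime3_dvd:
  fixes n :: nat
  assumes "n mod 4 = 3"
  shows "\<exists>p. prime3 p \<and> p dvd n"
  using assms
proof (induction n rule: prime_divisors_induct)
  case (factor p x)
  have "(p mod 4) * (x mod 4) mod 4 = 3" using factor.prems by (simp add: mod_mult_eq)
  moreover have "p mod 4 \<in> {0, 1, 2, 3}" "x mod 4 \<in> {0, 1, 2, 3}" by auto
  ultimately have "p mod 4 = 3 \<or> x mod 4 = 3" by auto
  then show ?case
  proof
    assume "x mod 4 = 3"
    then show ?case using factor.IH dvd_mult by blast
  qed (use factor.hyps in \<open>auto simp: prime3_def\<close>)
qed auto

lemma frakB_mod_4: "n \<in> frakB \<Longrightarrow> n mod 4 = 1"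
proof -
  assume "n \<in> frakB"
  then obtain x y :: int where n: "odd n" "int n = x\<^sup>2 + y\<^sup>2" by (auto simp: frakB_def)
  have sq: "a\<^sup>2 mod 4 \<in> {0, 1}" for a :: int
  proof -
    have "a mod 4 \<in> {0, 1, 2, 3}" by auto
    moreover have "a\<^sup>2 mod 4 = (a mod 4)\<^sup>2 mod 4" by (simp add: power_mod)
    ultimately show ?thesis by auto
  qed
  have "odd (int n)" using n(1) by simp
  then have "int n mod 4 = 1 \<or> int n mod 4 = 3" by presburger
  moreover have "int n mod 4 = (x\<^sup>2 mod 4 + y\<^sup>2 mod 4) mod 4"
    by (simp add: n(2) mod_add_eq)
  ultimately have "int n mod 4 = 1" using sq[of x] sq[of y] by auto
  then show ?thesis by presburger
qed

lemma frakB_iff: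
  assumes "n > 0"
  shows "n \<in> frakB \<longleftrightarrow> odd n \<and> (\<forall>p. prime3 p \<longrightarrow> \<not> p dvd n)"
proof
  assume n: "n \<in> frakB"
  then obtain x y :: int where "odd n" "coprime x y" "int n = x\<^sup>2 + y\<^sup>2"
    by (auto simp: frakB_def)
  then show "odd n \<and> (\<forall>p. prime3 p \<longrightarrow> \<not> p dvd n)"
    using not_prime3_dvd_sum_squares by (metis of_nat_dvd_iff)
next
  assume n: "odd n \<and> (\<forall>p. prime3 p \<longrightarrow> \<not> p dvd n)"
  show "n \<in> frakB"
  proof (cases "n = 1")
    case True
    have "coprime (1 :: int) 0 \<and> int n = 1\<^sup>2 + 0\<^sup>2" using True by simp
    then show ?thesis using n unfolding frakB_def by blast
  next
    case False
    have "p mod 4 = 1" if "prime p" "p dvd n" for p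
    proof -
      have "odd p" using that n dvd_trans by blast
      then have "p mod 4 = 1 \<or> p mod 4 = 3" by presburger
      then show ?thesis using that n by (auto simp: prime3_def)
    qed
    then obtain s where s: "int n dvd s\<^sup>2 + 1" using sqrt_minus_one_mod assms by blast
    then obtain x y t where xy: "x = s * y + int n * t" "x\<^sup>2 + y\<^sup>2 = int n"
      using thue_two_squares[of n s] n assms False by auto
    obtain m where m: "s\<^sup>2 + 1 = int n * m" using s by blast
    \<comment> \<open>Dividing x^2 + y^2 = n by \<open>n\<close>, with x = s y + n t inserted,
      leaves a Bezout identity for \<open>x\<close> and \<open>y\<close>; this yields their
      coprimality.\<close>
    have "int n * (y * (m * y + s * t) + x * t) = (s\<^sup>2 + 1) * y\<^sup>2 + int n * (s * y * t + x * t)"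
      unfolding m by (simp add: power2_eq_square algebra_simps)
    also have "\<dots> = x\<^sup>2 + y\<^sup>2"
      unfolding xy(1) by (simp add: power2_eq_square algebra_simps)
    finally have "y * (m * y + s * t) + x * t = 1"
      using xy(2) assms by simp
    then have "coprime x y"
      by (metis coprimeI dvd_add dvd_mult2)
    then show ?thesis using n xy(2)[symmetric] unfolding frakB_def by blast
  qed
qed

text \<open>If \<open>q\<close> is a prime congruent to 3 dividing \<open>n\<close>, the cofactor is
  again 3 modulo 4 and has such a prime factor \<open>r\<close>, possibly equal to \<open>q\<close>.
  The smaller of the two has square at most q r, hence at most \<open>n\<close>.\<close>

lemma frakB_iff_small:
  assumes "n \<le> N" "n mod 4 = 1" "\<And>p. p\<^sup>2 \<le> N \<Longrightarrow> p \<le> z"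
  shows "n \<in> frakB \<longleftrightarrow> (\<forall>p\<le>z. prime3 p \<longrightarrow> \<not> p dvd n)"
proof -
  have n: "odd n" "n > 0" using assms(2) by presburger+
  have "\<exists>p\<le>z. prime3 p \<and> p dvd n" if q: "prime3 q" "q dvd n" for q
  proof -
    obtain m where m: "n = q * m" using q(2) by blast
    have "(q mod 4) * (m mod 4) mod 4 = 1" using assms(2) m by (simp add: mod_mult_eq)
    moreover have "m mod 4 \<in> {0, 1, 2, 3}" by auto
    ultimately have "m mod 4 = 3" using that(1) by (auto simp: prime3_def)
    then obtain r where r: "prime3 r" "r dvd m" using ex_prime3_dvd by blast
    have "m > 0" using m n by (cases m) auto
    then have "r \<le> m" using r by (simp add: dvd_imp_le)
    then have "q * r \<le> n" using m by simp
    moreover have "(min q r)\<^sup>2 \<le> q * r" unfolding power2_eq_square by (intro mult_mono) auto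
    ultimately have "min q r \<le> z" using assms by (meson order_trans)
    moreover have "min q r = q \<or> min q r = r" by linarith
    ultimately show ?thesis using that r m by (metis dvd_mult)
  qed
  then show ?thesis using frakB_iff[OF n(2)] n(1) by blast
qed

subsection \<open>Additive characters\<close>

lemma expi_cis: "expi x = cis (2 * pi * x)"
  by (simp add: expi_def cis_conv_exp algebra_simps)

lemma norm_expi [simp]: "norm (expi x) = 1"
  by (simp add: expi_cis)

lemma expi_add: "expi (x + y) = expi x * expi y"
  by (simp add: expi_cis cis_mult algebra_simps)

lemma cnj_expi: "cnj (expi x) = expi (- x)"
  by (simp add: expi_cis cis_cnj)

lemma expi_of_nat_mult: "expi (real n * x) = expi x ^ n"
  by (simp add: expi_cis Complex.DeMoivre algebra_simps)

lemma expi_of_int [simp]: "expi (of_int m) = 1"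
  by (simp add: expi_cis cis_multiple_2pi)

subsection \<open>Distance to the nearest integer\<close>

definition dist_int :: "real \<Rightarrow> real" where
  "dist_int x = \<bar>x - of_int (round x)\<bar>"

lemma dist_int_le: "dist_int x \<le> \<bar>x - of_int m\<bar>"
  unfolding dist_int_def by (rule round_diff_minimal)

lemma dist_int_le_half: "dist_int x \<le> 1/2"
  using of_int_round_abs_le[of x] by (simp add: dist_int_def abs_minus_commute)

text \<open>Weaker than Jordan's inequality by a factor 2, which only affects constants. Up to pi/3
  the function sin x - x/2 is nondecreasing; beyond, monotonicity of the sine suffices.\<close>

lemma sin_ge_div_pi:
  fixes x :: real
  assumes "0 \<le> x" "x \<le> pi / 2"
  shows "x / pi \<le> sin x"
proof (cases "x \<le> pi / 3")
  case True
  have "sin 0 - 0 / 2 \<le> sin x - x / (2::real)"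
  proof (rule DERIV_nonneg_imp_nondecreasing[OF assms(1)])
    fix t assume t: "0 \<le> t" "t \<le> x"
    have "cos (pi / 3) \<le> cos t"
      using t True by (intro cos_monotone_0_pi_le) auto
    then show "\<exists>y. ((\<lambda>a. sin a - a / 2) has_real_derivative y) (at t) \<and> 0 \<le> y"
      by (intro exI[of _ "cos t - 1 / 2"]) (auto intro!: derivative_eq_intros simp: cos_60)
  qed
  moreover have "x / pi \<le> x / 2"
    using assms pi_ge_two by (intro divide_left_mono) auto
  ultimately show ?thesis unfolding sin_zero by linarith
next
  case False
  have "sin (pi / 3) \<le> sin x"
    using False assms by (intro sin_monotone_2pi_le) auto
  moreover have "x / pi \<le> 1 / 2"
    using assms by (simp add: field_simps)
  moreover have "1 \<le> sqrt 3" by simp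
  ultimately show ?thesis unfolding sin_60 by linarith
qed

lemma norm_one_minus_expi_ge: "2 * dist_int x \<le> norm (1 - expi x)"
proof -
  define r where "r = x - of_int (round x)"
  have "expi x = expi r * expi (of_int (round x))"
    by (simp only: expi_add[symmetric]) (simp add: r_def)
  then have "expi x = exp (\<i> * of_real (2 * pi * r))"
    by (simp add: expi_cis[of r] cis_conv_exp)
  then have "norm (1 - expi x) = norm (exp (\<i> * of_real (2 * pi * r)) - 1)"
    by (simp add: norm_minus_commute)
  also have "\<dots> = 2 * \<bar>sin (pi * r)\<bar>"
    by (simp add: dist_exp_i_1 del: of_real_mult)
  also have "\<bar>sin (pi * r)\<bar> = sin (pi * \<bar>r\<bar>)"
  proof -
    have "pi * \<bar>r\<bar> \<le> pi * 1"
      using dist_int_le_half[of x] by (intro mult_left_mono) (auto simp: dist_int_def r_def)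
    then have "0 \<le> sin (pi * \<bar>r\<bar>)"
      by (intro sin_ge_zero) auto
    then show ?thesis by (cases "r \<ge> 0") auto
  qed
  finally have eq: "norm (1 - expi x) = 2 * sin (pi * \<bar>r\<bar>)" .
  have "sin (pi * \<bar>r\<bar>) \<ge> pi * \<bar>r\<bar> / pi"
  proof (rule sin_ge_div_pi)
    show "pi * \<bar>r\<bar> \<le> pi / 2"
      using mult_left_mono[of "\<bar>r\<bar>" "1/2" pi] dist_int_le_half[of x]
      by (auto simp: dist_int_def r_def)
  qed auto
  then show ?thesis by (simp add: eq r_def dist_int_def)
qed

section \<open>Geometric sums and reciprocal sums over spaced points\<close>

lemma norm_geometric_expi_le:
  assumes "dist_int x > 0"
  shows "norm (\<Sum>j<n. expi (real j * x)) \<le> 1 / dist_int x"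
proof -
  have ne: "norm (1 - expi x) > 0"
    using norm_one_minus_expi_ge[of x] assms by linarith
  then have "expi x \<noteq> 1" by auto
  then have "(\<Sum>j<n. expi (real j * x)) = (1 - expi x ^ n) / (1 - expi x)"
    by (simp add: expi_of_nat_mult sum_gp_strict)
  moreover have "norm (1 - expi x ^ n) \<le> 2"
    using norm_triangle_ineq4[of 1 "expi x ^ n"] by (simp add: norm_power)
  ultimately have "norm (\<Sum>j<n. expi (real j * x)) \<le> 2 / norm (1 - expi x)"
    using ne by (simp add: norm_divide divide_right_mono)
  also have "\<dots> \<le> 2 / (2 * dist_int x)"
    using norm_one_minus_expi_ge[of x] assms ne by (intro divide_left_mono) auto
  finally show ?thesis by simp
qed

lemma harm_le_ln_plus_one: "n > 0 \<Longrightarrow> harm n \<le> ln (real n) + 1"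
proof (induction n rule: nat_induct_non_zero)
  case 1
  show ?case by (simp add: harm_expand)
next
  case (Suc n)
  have "harm (Suc n) - ln (real (Suc n)) \<le> harm (Suc 0) - ln (real (Suc 0))"
    using decseq_harm_diff_ln unfolding decseq_def by blast
  then show ?case by (simp add: harm_expand)
qed

text \<open>The integer parts of the points divided by \<open>\<delta>\<close> are pairwise distinct and nonzero, so the
  sum is dominated by a harmonic sum over positive and negative integers.\<close>

lemma sum_inverse_spaced_le:
  fixes r :: "'a \<Rightarrow> real" and \<delta> :: real and n :: nat
  assumes fin: "finite S" and \<delta>: "\<delta> > 0" and n: "n > 0" "1 / 2 \<le> n * \<delta>"
    and sep: "\<And>s t. s \<in> S \<Longrightarrow> t \<in> S \<Longrightarrow> s \<noteq> t \<Longrightarrow> \<delta> \<le> \<bar>r s - r t\<bar>"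
    and lower: "\<And>s. s \<in> S \<Longrightarrow> \<delta> \<le> \<bar>r s\<bar>"
    and upper: "\<And>s. s \<in> S \<Longrightarrow> \<bar>r s\<bar> \<le> 1 / 2"
  shows "(\<Sum>s\<in>S. 1 / \<bar>r s\<bar>) \<le> 4 / \<delta> * (ln (real n) + 1)"
proof -
  define j where "j s = \<lfloor>r s / \<delta>\<rfloor>" for s
  have inj: "inj_on j S"
  proof (rule inj_onI, rule ccontr)
    fix s t assume st: "s \<in> S" "t \<in> S" "j s = j t" "s \<noteq> t"
    have "1 \<le> \<bar>r s - r t\<bar> / \<delta>"
      using sep[OF st(1,2,4)] \<delta> by simp
    also have "\<dots> = \<bar>r s / \<delta> - r t / \<delta>\<bar>"
      using \<delta> by (simp add: diff_divide_distrib[symmetric])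
    finally show False
      using st(3) unfolding j_def by linarith
  qed
  have j: "j s \<noteq> 0 \<and> \<bar>j s\<bar> \<le> int n \<and> 1 / \<bar>r s\<bar> \<le> 2 / \<delta> * (1 / \<bar>j s\<bar>)" if s: "s \<in> S" for s
  proof -
    define x where "x = r s / \<delta>"
    have rx: "r s = x * \<delta>" using \<delta> by (simp add: x_def)
    have x1: "1 \<le> \<bar>x\<bar>"
      using lower[OF s] \<delta> by (simp add: x_def)
    have "\<bar>x\<bar> * \<delta> \<le> n * \<delta>"
      using upper[OF s] n(2) \<delta> by (simp add: x_def)
    then have xn: "\<bar>x\<bar> \<le> n" using \<delta> by simp
    have js: "j s = \<lfloor>x\<rfloor>" by (simp add: j_def x_def)
    have ne: "j s \<noteq> 0"
    proof
      assume "j s = 0"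
      then have fx: "\<lfloor>x\<rfloor> = 0" using js by simp
      have "0 \<le> x" "x < 1" using fx by linarith+
      then show False using x1 by linarith
    qed
    have le: "\<bar>j s\<bar> \<le> int n"
      using xn unfolding js by linarith
    \<comment> \<open>For negative \<open>x\<close> the floor may exceed \<open>x\<close> in
      absolute value, but by less than 1, hence by less than |x|. This costs the factor 2.\<close>
    have "real_of_int \<bar>j s\<bar> \<le> 2 * \<bar>x\<bar>"
      using x1 unfolding js by linarith
    moreover have "0 < real_of_int \<bar>j s\<bar>" using ne by simp
    ultimately have "1 / \<bar>x\<bar> \<le> 2 * (1 / \<bar>j s\<bar>)"
      using x1 by (simp add: field_simps)
    then have "1 / \<bar>x\<bar> / \<delta> \<le> 2 * (1 / \<bar>j s\<bar>) / \<delta>"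
      using \<delta> by (intro divide_right_mono) auto
    then show ?thesis using ne le \<delta> by (simp add: rx abs_mult mult.commute)
  qed
  have "(\<Sum>s\<in>S. 1 / \<bar>r s\<bar>) \<le> (\<Sum>s\<in>S. 2 / \<delta> * (1 / \<bar>j s\<bar>))"
    using j by (intro sum_mono) auto
  also have "\<dots> = 2 / \<delta> * (\<Sum>i\<in>j ` S. 1 / \<bar>i\<bar>)"
    by (simp add: sum_distrib_left sum.reindex[OF inj])
  also have "(\<Sum>i\<in>j ` S. 1 / real_of_int \<bar>i\<bar>) \<le> (\<Sum>i\<in>int ` {1..n} \<union> (\<lambda>i. - int i) ` {1..n}. 1 / real_of_int \<bar>i\<bar>)"
  proof (rule sum_mono2)
    show "j ` S \<subseteq> int ` {1..n} \<union> (\<lambda>i. - int i) ` {1..n}"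
    proof
      fix i assume "i \<in> j ` S"
      then have "i \<noteq> 0" "\<bar>i\<bar> \<le> int n" using j by auto
      then have "nat \<bar>i\<bar> \<in> {1..n}" "i = int (nat \<bar>i\<bar>) \<or> i = - int (nat \<bar>i\<bar>)" by auto
      then show "i \<in> int ` {1..n} \<union> (\<lambda>i. - int i) ` {1..n}" by blast
    qed
  qed auto
  also have "\<dots> \<le> (\<Sum>i\<in>int ` {1..n}. 1 / real_of_int \<bar>i\<bar>) + (\<Sum>i\<in>(\<lambda>i. - int i) ` {1..n}. 1 / real_of_int \<bar>i\<bar>)"
    by (subst sum.union_inter[symmetric]) (auto intro!: sum_nonneg)
  also have "\<dots> = 2 * harm n"
    by (simp add: sum.reindex inj_on_def harm_def divide_inverse)
  also have "2 * harm n \<le> 2 * (ln (real n) + 1)"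
    using harm_le_ln_plus_one[OF n(1)] by simp
  finally show ?thesis using \<delta> by (simp add: field_simps)
qed

text \<open>Bad approximability of sqrt 2, the only Diophantine input: 2h^2 - m^2 is a nonzero
  integer, and it factors as (x - m)(x + m) with x = h sqrt 2 and second factor at most 4h.\<close>

lemma dist_int_mult_sqrt2_ge:
  assumes "h > 0"
  shows "1 / (4 * real h) \<le> dist_int (real h * sqrt 2)"
proof -
  define m where "m = round (real h * sqrt 2)"
  define x where "x = real h * sqrt 2"
  define t where "t = \<bar>x - of_int m\<bar>"
  have t: "t \<le> 1 / 2" "dist_int x = t"
    using dist_int_le_half[of x] by (simp_all add: t_def dist_int_def m_def x_def)
  have h: "1 \<le> real h" using assms by simp
  have s2: "sqrt 2 \<le> 3 / 2" by (rule real_le_lsqrt) (auto simp: power2_eq_square)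
  have x: "x \<le> real h * (3 / 2)" "0 \<le> x"
    unfolding x_def using s2 by (intro mult_left_mono) auto
  \<comment> \<open>The exponent of 2 is odd on the left and even on the right.\<close>
  have "2 * int h * int h \<noteq> m * m"
  proof
    assume eq: "2 * int h * int h = m * m"
    then have "m \<noteq> 0" using assms by auto
    then have "multiplicity 2 (m * m) = 2 * multiplicity 2 m"
      by (subst prime_elem_multiplicity_mult_distrib) auto
    moreover have "multiplicity 2 (2 * int h * int h) = 1 + 2 * multiplicity 2 (int h)"
      using assms by (simp add: prime_elem_multiplicity_mult_distrib)
    ultimately show False using eq by simp presburger
  qed
  then have "1 \<le> \<bar>2 * int h * int h - m * m\<bar>" by simp
  then have "1 \<le> \<bar>real_of_int (2 * int h * int h - m * m)\<bar>" by linarith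
  also have "real_of_int (2 * int h * int h - m * m) = (x - m) * (x + m)"
    by (simp add: x_def algebra_simps)
  also have "\<bar>(x - m) * (x + m)\<bar> = t * \<bar>x + m\<bar>"
    by (simp add: t_def abs_mult)
  also have "\<dots> \<le> t * (4 * real h)"
  proof (rule mult_left_mono)
    have "\<bar>x + m\<bar> \<le> 2 * x + t" using x unfolding t_def by linarith
    then show "\<bar>x + m\<bar> \<le> 4 * real h" using x t h by linarith
  qed (simp add: t_def)
  finally show ?thesis using h t by (simp add: x_def field_simps)
qed

subsection \<open>Bilinear and linear sums\<close>

lemma dist_int_minus: "dist_int (- x) = dist_int x"
proof (rule antisym)
  show "dist_int (- x) \<le> dist_int x"
    using dist_int_le[of "- x" "- round x"] by (simp add: dist_int_def abs_minus_commute)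
  show "dist_int x \<le> dist_int (- x)"
    using dist_int_le[of x "- round (- x)"] by (simp add: dist_int_def abs_minus_commute)
qed

lemma dist_int_diff_mult_sqrt2_ge:
  fixes D m n :: nat
  assumes "m \<in> {D..<2 * D}" "n \<in> {D..<2 * D}" "m \<noteq> n"
  shows "1 / (4 * real D) \<le> dist_int ((real m - real n) * sqrt 2)"
proof -
  have *: "1 / (4 * real D) \<le> dist_int ((real m - real n) * sqrt 2)"
    if "m \<in> {D..<2 * D}" "n \<in> {D..<2 * D}" "n < m" for m n
  proof -
    have "1 / (4 * real D) \<le> 1 / (4 * real (m - n))"
      using that by (intro divide_left_mono) auto
    also have "\<dots> \<le> dist_int (real (m - n) * sqrt 2)"
      using that by (intro dist_int_mult_sqrt2_ge) auto
    finally show ?thesis using that by (simp add: of_nat_diff)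
  qed
  show ?thesis
  proof (cases "n < m")
    case False
    then have "1 / (4 * real D) \<le> dist_int (- ((real n - real m) * sqrt 2))"
      unfolding dist_int_minus using assms by (intro *) auto
    then show ?thesis by (simp add: algebra_simps)
  qed (use * assms in auto)
qed

lemma sum_inverse_dist_int_le:
  fixes D :: nat
  assumes A: "A \<subseteq> {D..<2 * D}" and d: "d \<in> A"
  shows "(\<Sum>d'\<in>A - {d}. 1 / dist_int ((real d - real d') * sqrt 2)) \<le> 16 * D * (ln (2 * D) + 1)"
proof -
  \<comment> \<open>Signed distances are needed: the points must be spaced on the real line, and r s
    - r t differs from (t - s) sqrt 2 by an integer.\<close>
  define r where "r d' = (real d - real d') * sqrt 2 - of_int (round ((real d - real d') * sqrt 2))" for d'
  have D: "D > 0" using A d by auto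
  have abs_r: "\<bar>r d'\<bar> = dist_int ((real d - real d') * sqrt 2)" for d'
    by (simp add: r_def dist_int_def)
  have "(\<Sum>d'\<in>A - {d}. 1 / \<bar>r d'\<bar>) \<le> 4 / (1 / (4 * real D)) * (ln (real (2 * D)) + 1)"
  proof (rule sum_inverse_spaced_le)
    show "finite (A - {d})" using A finite_subset by blast
    \<comment> \<open>With spacing 1/(4D), 2D cells on each side cover the interval from -1/2 to
      1/2.\<close>
    show "1 / 2 \<le> real (2 * D) * (1 / (4 * real D))" using D by simp
    fix s assume s: "s \<in> A - {d}"
    show "1 / (4 * real D) \<le> \<bar>r s\<bar>"
      unfolding abs_r using s A d by (intro dist_int_diff_mult_sqrt2_ge) auto
    show "\<bar>r s\<bar> \<le> 1 / 2"
      unfolding abs_r by (rule dist_int_le_half)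
    fix t assume t: "t \<in> A - {d}" "s \<noteq> t"
    have "1 / (4 * real D) \<le> dist_int ((real t - real s) * sqrt 2)"
      using s t A d by (intro dist_int_diff_mult_sqrt2_ge) auto
    also have "\<dots> \<le> \<bar>(real t - real s) * sqrt 2 - of_int (round ((real d - real s) * sqrt 2) - round ((real d - real t) * sqrt 2))\<bar>"
      by (rule dist_int_le)
    also have "\<dots> = \<bar>r s - r t\<bar>"
      unfolding r_def by (simp add: algebra_simps)
    finally show "1 / (4 * real D) \<le> \<bar>r s - r t\<bar>" .
  qed (use D in auto)
  then show ?thesis by (simp add: abs_r mult.assoc)
qed

text \<open>The large sieve factor per coefficient: M/D bounds the diagonal, that is the number of
  admissible \<open>k\<close>, and the second term bounds the sum of the reciprocals of the
  distances from (d - d') sqrt 2 to the nearest integer over d' different from d.\<close>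

definition sieve_const :: "nat \<Rightarrow> nat \<Rightarrow> real" where
  "sieve_const M D = real M / real D + 16 * real D * (ln (2 * real D) + 1)"

lemma norm_sum_expi_le:
  assumes "dist_int x > 0"
  shows "norm (\<Sum>k=1..n. expi (real k * x)) \<le> 1 / dist_int x"
proof -
  have "(\<Sum>k=1..n. expi (real k * x)) = (\<Sum>j<n. expi (real (Suc j) * x))"
    by (rule sum.reindex_bij_witness[of _ Suc "\<lambda>k. k - 1"]) auto
  also have "\<dots> = expi x * (\<Sum>j<n. expi (real j * x))"
    by (simp add: sum_distrib_left expi_add[symmetric] algebra_simps)
  finally show ?thesis
    using norm_geometric_expi_le[OF assms] by (simp add: norm_mult)
qed

text \<open>Expanding the square and summing over \<open>k\<close> first gives correlations
  \<open>G d d'\<close>. The diagonal ones are counted trivially, the others are geometric sums in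
  (d - d') sqrt 2.\<close>

lemma sum_norm_square_expi_le:
  fixes D M :: nat and a :: "nat \<Rightarrow> complex"
  assumes A: "A \<subseteq> {D..<2 * D}" and a: "\<And>d. d \<in> A \<Longrightarrow> norm (a d) \<le> 1"
  shows "(\<Sum>k=1..M div D. (norm (\<Sum>d | d \<in> A \<and> d * k \<le> M. a d * expi (real (d * k) * sqrt 2)))\<^sup>2)
    \<le> card A * sieve_const M D"
proof -
  have fin: "finite A" using A finite_subset by blast
  define F where "F d k = (if d * k \<le> M then a d * expi (real (d * k) * sqrt 2) else 0)" for d k
  define G where "G d d' = (\<Sum>k=1..M div D. F d k * cnj (F d' k))" for d d'
  define x where "x d d' = (real d - real d') * sqrt 2" for d d'
  have G: "norm (G d d') \<le> (if d' = d then real M / real D else 1 / dist_int (x d d'))"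
    if d: "d \<in> A" "d' \<in> A" for d d'
  proof -
    have D: "0 < D" "D \<le> d" "D \<le> d'" using d A by auto
    \<comment> \<open>The two hyperbolic cutoffs together still describe an initial interval of
      \<open>k\<close>, so the inner sum stays geometric.\<close>
    define n where "n = min (M div d) (M div d')"
    have n: "k \<le> n \<longleftrightarrow> d * k \<le> M \<and> d' * k \<le> M" for k
      using D by (auto simp: n_def less_eq_div_iff_mult_less_eq mult.commute)
    have nD: "n \<le> M div D" using D by (auto simp: n_def intro: div_le_mono2 min.coboundedI1)
    have "G d d' = (\<Sum>k=1..n. F d k * cnj (F d' k))"
      unfolding G_def using nD n by (intro sum.mono_neutral_right) (auto simp: F_def)
    also have "\<dots> = (\<Sum>k=1..n. a d * cnj (a d') * expi (real k * x d d'))"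
    proof (rule sum.cong)
      fix k assume "k \<in> {1..n}"
      then have "d * k \<le> M" "d' * k \<le> M" using n by auto
      moreover have "expi (real k * x d d') = expi (real (d * k) * sqrt 2) * expi (- (real (d' * k) * sqrt 2))"
        by (simp add: x_def expi_add[symmetric] algebra_simps)
      ultimately show "F d k * cnj (F d' k) = a d * cnj (a d') * expi (real k * x d d')"
        by (simp add: F_def cnj_expi)
    qed simp
    also have "norm \<dots> = norm (a d) * norm (a d') * norm (\<Sum>k=1..n. expi (real k * x d d'))"
      by (simp add: sum_distrib_left[symmetric] norm_mult)
    also have "\<dots> \<le> 1 * 1 * norm (\<Sum>k=1..n. expi (real k * x d d'))"
      using a d by (intro mult_mono) auto
    finally have le: "norm (G d d') \<le> norm (\<Sum>k=1..n. expi (real k * x d d'))" by simp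
    show ?thesis
    proof (cases "d' = d")
      case True
      have "norm (\<Sum>k=1..n. expi (real k * x d d')) \<le> (\<Sum>k=1..n. 1)"
        by (rule sum_norm_le) simp
      also have "\<dots> \<le> real (M div D)" using nD by simp
      also have "\<dots> \<le> real M / real D" by (rule of_nat_div_le_of_nat) 
      finally show ?thesis using le True by simp
    next
      case False
      have "0 < 1 / (4 * real D)" using D by simp
      also have "\<dots> \<le> dist_int (x d d')"
        unfolding x_def using A d False by (intro dist_int_diff_mult_sqrt2_ge) auto
      finally show ?thesis using norm_sum_expi_le le False by (force intro: order_trans)
    qed
  qed
  have *: "of_real ((norm (\<Sum>d | d \<in> A \<and> d * k \<le> M. a d * expi (real (d * k) * sqrt 2)))\<^sup>2)
    = (\<Sum>d\<in>A. \<Sum>d'\<in>A. F d k * cnj (F d' k))" for k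
  proof -
    have "(\<Sum>d | d \<in> A \<and> d * k \<le> M. a d * expi (real (d * k) * sqrt 2)) = (\<Sum>d\<in>A. F d k)"
      using fin by (simp add: F_def sum.inter_filter del: of_nat_mult)
    then show ?thesis by (simp only: complex_norm_square cnj_sum sum_product)
  qed
  have "complex_of_real (\<Sum>k=1..M div D. (norm (\<Sum>d | d \<in> A \<and> d * k \<le> M. a d * expi (real (d * k) * sqrt 2)))\<^sup>2)
      = (\<Sum>k=1..M div D. \<Sum>d\<in>A. \<Sum>d'\<in>A. F d k * cnj (F d' k))"
    by (simp only: of_real_sum *)
  also have "\<dots> = (\<Sum>d\<in>A. \<Sum>d'\<in>A. G d d')"
    unfolding G_def by (subst sum.swap, rule sum.cong[OF refl], rule sum.swap)
  finally have "norm (complex_of_real (\<Sum>k=1..M div D. (norm (\<Sum>d | d \<in> A \<and> d * k \<le> M. a d * expi (real (d * k) * sqrt 2)))\<^sup>2))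
      = norm (\<Sum>d\<in>A. \<Sum>d'\<in>A. G d d')" by simp
  also have "\<dots> \<le> (\<Sum>d\<in>A. sieve_const M D)"
  proof (rule sum_norm_le)
    fix d assume d: "d \<in> A"
    have "norm (\<Sum>d'\<in>A. G d d') \<le> (\<Sum>d'\<in>A. if d' = d then real M / real D else 1 / dist_int (x d d'))"
      using G d by (intro sum_norm_le) auto
    also have "\<dots> = real M / real D + (\<Sum>d'\<in>A - {d}. 1 / dist_int (x d d'))"
      by (subst sum.remove[OF fin d]) simp
    also have "\<dots> \<le> sieve_const M D"
      using sum_inverse_dist_int_le[OF A d] by (simp add: sieve_const_def x_def)
    finally show "norm (\<Sum>d'\<in>A. G d d') \<le> sieve_const M D" .
  qed
  finally show ?thesis
    by (simp add: norm_of_real abs_of_nonneg sum_nonneg del: of_real_sum)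
qed

text \<open>For each \<open>k\<close> only one class \<open>U d = w\<close> contributes; bounding it by all classes frees the
  range of \<open>k\<close>, and costs nothing since the classes partition \<open>A\<close>.\<close>

lemma sum_norm_square_expi_classes_le:
  fixes D M :: nat and a :: "nat \<Rightarrow> complex" and U V :: "nat \<Rightarrow> 'w"
  assumes A: "A \<subseteq> {D..<2 * D}" and a: "\<And>d. d \<in> A \<Longrightarrow> norm (a d) \<le> 1"
  shows "(\<Sum>k=1..M div D. (norm (\<Sum>d | d \<in> A \<and> U d = V k \<and> d * k \<le> M. a d * expi (real (d * k) * sqrt 2)))\<^sup>2)
    \<le> card A * sieve_const M D"
proof -
  have fin: "finite A" using A finite_subset by blast
  define C where "C w = {d \<in> A. U d = w}" for w
  define H where "H w k = (\<Sum>d | d \<in> C w \<and> d * k \<le> M. a d * expi (real (d * k) * sqrt 2))" for w k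
  have "(norm (H (V k) k))\<^sup>2 \<le> (\<Sum>w\<in>U ` A. (norm (H w k))\<^sup>2)" for k
  proof (cases "V k \<in> U ` A")
    case True
    then show ?thesis using fin by (intro member_le_sum) auto
  next
    case False
    then have "C (V k) = {}" unfolding C_def by (metis (mono_tags, lifting) Collect_empty_eq imageI)
    then show ?thesis by (simp add: H_def sum_nonneg)
  qed
  then have "(\<Sum>k=1..M div D. (norm (H (V k) k))\<^sup>2) \<le> (\<Sum>k=1..M div D. \<Sum>w\<in>U ` A. (norm (H w k))\<^sup>2)"
    by (intro sum_mono)
  also have "\<dots> = (\<Sum>w\<in>U ` A. \<Sum>k=1..M div D. (norm (H w k))\<^sup>2)"
    by (rule sum.swap)
  also have "\<dots> \<le> (\<Sum>w\<in>U ` A. card (C w) * sieve_const M D)"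
    unfolding H_def using A a by (intro sum_mono sum_norm_square_expi_le) (auto simp: C_def)
  also have "\<dots> = (\<Sum>w\<in>U ` A. card (C w)) * sieve_const M D"
    by (simp add: sum_distrib_right)
  also have "(\<Sum>w\<in>U ` A. card (C w)) = card A"
    using sum.image_gen[OF fin, of "\<lambda>_. 1::nat" U] by (simp add: C_def)
  finally show ?thesis
    by (simp add: H_def C_def conj_assoc)
qed

text \<open>Cauchy's inequality over at most M/D values of \<open>k\<close>. With
  \<open>card A\<close> at most D the product of the two lengths is at most M.\<close>

lemma sum_norm_expi_classes_le:
  fixes D M :: nat and a :: "nat \<Rightarrow> complex" and U V :: "nat \<Rightarrow> 'w"
  assumes A: "A \<subseteq> {D..<2 * D}" and a: "\<And>d. d \<in> A \<Longrightarrow> norm (a d) \<le> 1" and D: "D > 0"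
  shows "(\<Sum>k=1..M div D. norm (\<Sum>d | d \<in> A \<and> U d = V k \<and> d * k \<le> M. a d * expi (real (d * k) * sqrt 2)))
    \<le> sqrt (M * sieve_const M D)"
proof (rule real_le_rsqrt)
  define h where "h k = norm (\<Sum>d | d \<in> A \<and> U d = V k \<and> d * k \<le> M. a d * expi (real (d * k) * sqrt 2))" for k
  have pos: "sieve_const M D \<ge> 0"
    unfolding sieve_const_def using D by (intro add_nonneg_nonneg mult_nonneg_nonneg ln_ge_zero) auto
  have "card A \<le> card {D..<2 * D}" using A by (intro card_mono) auto
  then have cA: "card A \<le> D" by simp
  have "(\<Sum>k=1..M div D. h k)\<^sup>2 \<le> (\<Sum>k=1..M div D. (h k)\<^sup>2) * card {1..M div D}"
    by (rule sum_squared_le_sum_of_squares)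
  also have "\<dots> \<le> (card A * sieve_const M D) * (M div D)"
    unfolding h_def using sum_norm_square_expi_classes_le[OF A a, where M = M and U = U and V = V] by (intro mult_mono) (auto simp: pos)
  also have "\<dots> \<le> (D * sieve_const M D) * (M / D)"
    using pos cA by (intro mult_mono of_nat_div_le_of_nat) auto
  also have "\<dots> = M * sieve_const M D" using D by simp
  finally show "(\<Sum>k=1..M div D. h k)\<^sup>2 \<le> M * sieve_const M D" .
qed

text \<open>Only the term at the highest binary digit where \<open>u\<close> and \<open>v\<close> differ survives.\<close>

lemma of_bool_less_binary:
  fixes u v :: nat
  assumes "u < 2 ^ J" "v < 2 ^ J"
  shows "of_bool (u < v) = (\<Sum>j<J. of_bool (even (u div 2 ^ j) \<and> Suc (u div 2 ^ j) = v div 2 ^ j) :: complex)"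
  using assms
proof (induction J arbitrary: u v)
  case (Suc J)
  have "of_bool (u < v) = (of_bool (even u \<and> Suc u = v) + of_bool (u div 2 < v div 2) :: complex)"
  proof -
    have "u < v \<longleftrightarrow> (even u \<and> Suc u = v) \<or> u div 2 < v div 2" by presburger
    moreover have "\<not> ((even u \<and> Suc u = v) \<and> u div 2 < v div 2)" by presburger
    ultimately show ?thesis by auto
  qed
  also have "of_bool (u div 2 < v div 2) = (\<Sum>j<J. of_bool (even (u div 2 div 2 ^ j) \<and> Suc (u div 2 div 2 ^ j) = v div 2 div 2 ^ j) :: complex)"
    using Suc.prems by (intro Suc.IH) auto
  finally show ?case
    by (simp add: sum.lessThan_Suc_shift div_mult2_eq del: sum.lessThan_Suc of_bool_conj)
qed simp

lemma norm_bilinear_expi_le: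
  fixes D M J :: nat and a :: "nat \<Rightarrow> complex" and u v :: "nat \<Rightarrow> nat" and \<rho> \<sigma> :: "nat \<Rightarrow> 'w"
  assumes A: "A \<subseteq> {D..<2 * D}" and a: "\<And>d. d \<in> A \<Longrightarrow> norm (a d) \<le> 1" and D: "D > 0"
    and u: "\<And>d. d \<in> A \<Longrightarrow> u d < 2 ^ J" and v: "\<And>k. v k < 2 ^ J"
  shows "norm (\<Sum>d\<in>A. \<Sum>k=1..M div d. of_bool (u d < v k \<and> \<rho> d = \<sigma> k) * a d * expi (real (d * k) * sqrt 2))
    \<le> J * sqrt (M * sieve_const M D)"
proof -
  have fin: "finite A" using A finite_subset by blast
  \<comment> \<open>At digit \<open>j\<close> the condition on the prefixes is an equality between a
    function of \<open>d\<close> and a function of \<open>k\<close>, the form of the class lemma.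
    The parity condition depends on \<open>d\<close> alone and goes into the coefficient
    \<open>b\<close>.\<close>
  define U where "U j d = (Suc (u d div 2 ^ j), \<rho> d)" for j d
  define V where "V j k = (v k div 2 ^ j, \<sigma> k)" for j k
  define b where "b j d = of_bool (even (u d div 2 ^ j)) * a d" for j d
  define e where "e d k = expi (real (d * k) * sqrt 2)" for d k
  have "(\<Sum>d\<in>A. \<Sum>k=1..M div d. of_bool (u d < v k \<and> \<rho> d = \<sigma> k) * a d * e d k)
      = (\<Sum>d\<in>A. \<Sum>k=1..M div D. \<Sum>j<J. if U j d = V j k \<and> d * k \<le> M then b j d * e d k else 0)"
  proof (rule sum.cong[OF refl])
    fix d assume d: "d \<in> A"
    have Dd: "0 < D" "D \<le> d" using d A D by auto
    \<comment> \<open>The range of \<open>k\<close> is made independent of \<open>d\<close>; the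
      hyperbolic condition moves into the summand.\<close>
    have "(\<Sum>k=1..M div d. of_bool (u d < v k \<and> \<rho> d = \<sigma> k) * a d * e d k)
        = (\<Sum>k=1..M div D. if d * k \<le> M then of_bool (u d < v k \<and> \<rho> d = \<sigma> k) * a d * e d k else 0)"
      using Dd div_le_mono2[of D d M]
      by (intro sum.mono_neutral_cong_left) (auto simp: less_eq_div_iff_mult_less_eq mult.commute not_le)
    also have "\<dots> = (\<Sum>k=1..M div D. \<Sum>j<J. if U j d = V j k \<and> d * k \<le> M then b j d * e d k else 0)"
    proof (rule sum.cong[OF refl])
      fix k
      have "of_bool (u d < v k \<and> \<rho> d = \<sigma> k) * a d * e d k
          = (\<Sum>j<J. of_bool (even (u d div 2 ^ j) \<and> Suc (u d div 2 ^ j) = v k div 2 ^ j)) * (of_bool (\<rho> d = \<sigma> k) * a d * e d k)"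
        unfolding of_bool_less_binary[OF u[OF d] v, of k, symmetric] by (simp add: of_bool_conj)
      also have "\<dots> = (\<Sum>j<J. if U j d = V j k then b j d * e d k else 0)"
        unfolding sum_distrib_right by (intro sum.cong) (auto simp: U_def V_def b_def)
      finally show "(if d * k \<le> M then of_bool (u d < v k \<and> \<rho> d = \<sigma> k) * a d * e d k else 0)
          = (\<Sum>j<J. if U j d = V j k \<and> d * k \<le> M then b j d * e d k else 0)"
        by (cases "d * k \<le> M") simp_all
    qed
    finally show "(\<Sum>k=1..M div d. of_bool (u d < v k \<and> \<rho> d = \<sigma> k) * a d * e d k)
        = (\<Sum>k=1..M div D. \<Sum>j<J. if U j d = V j k \<and> d * k \<le> M then b j d * e d k else 0)" .
  qed
  also have "\<dots> = (\<Sum>k=1..M div D. \<Sum>d\<in>A. \<Sum>j<J. if U j d = V j k \<and> d * k \<le> M then b j d * e d k else 0)"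
    by (rule sum.swap)
  also have "\<dots> = (\<Sum>k=1..M div D. \<Sum>j<J. \<Sum>d\<in>A. if U j d = V j k \<and> d * k \<le> M then b j d * e d k else 0)"
    by (rule sum.cong[OF refl]) (rule sum.swap)
  also have "\<dots> = (\<Sum>j<J. \<Sum>k=1..M div D. \<Sum>d\<in>A. if U j d = V j k \<and> d * k \<le> M then b j d * e d k else 0)"
    by (rule sum.swap)
  also have "\<dots> = (\<Sum>j<J. \<Sum>k=1..M div D. \<Sum>d | d \<in> A \<and> U j d = V j k \<and> d * k \<le> M. b j d * e d k)"
    using fin by (simp add: sum.inter_filter)
  also have "norm \<dots> \<le> (\<Sum>j<J. sqrt (M * sieve_const M D))"
  proof (rule sum_norm_le)
    fix j
    have "norm (\<Sum>k=1..M div D. \<Sum>d | d \<in> A \<and> U j d = V j k \<and> d * k \<le> M. b j d * e d k)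
        \<le> (\<Sum>k=1..M div D. norm (\<Sum>d | d \<in> A \<and> U j d = V j k \<and> d * k \<le> M. b j d * e d k))"
      by (rule norm_sum)
    also have "\<dots> \<le> sqrt (M * sieve_const M D)"
      unfolding e_def using a by (intro sum_norm_expi_classes_le A D) (auto simp: b_def norm_mult)
    finally show "norm (\<Sum>k=1..M div D. \<Sum>d | d \<in> A \<and> U j d = V j k \<and> d * k \<le> M. b j d * e d k)
        \<le> sqrt (M * sieve_const M D)" .
  qed
  finally show ?thesis by (simp add: e_def)
qed

text \<open>An odd \<open>d\<close> is its own inverse modulo 4, so the admissible \<open>n\<close>
  are d (r + 4j) with r = d mod 4. The phases advance by 4 d sqrt 2, which is at least 1/(16 d) away
  from the integers.\<close>

lemma norm_sum_progression_le:
  assumes d: "odd d"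
  shows "norm (\<Sum>n | n \<in> {1..M} \<and> n mod 4 = 1 \<and> d dvd n. expi (real n * sqrt 2)) \<le> 16 * real d"
proof -
  define r where "r = d mod 4"
  \<comment> \<open>The number of j >= 0 with r + 4j at most M div d. Adding 4 first keeps the
    natural subtraction from truncating.\<close>
  define L where "L = (M div d + 4 - r) div 4"
  have d0: "d > 0" using d by (cases d) auto
  have r: "r = 1 \<or> r = 3" using d unfolding r_def by presburger
  have dk: "d * k mod 4 = 1 \<longleftrightarrow> k mod 4 = r" for k
  proof -
    have "d * k mod 4 = r * (k mod 4) mod 4" by (simp add: r_def mod_mult_eq)
    moreover have "k mod 4 \<in> {0, 1, 2, 3}" by auto
    ultimately show ?thesis using r by auto
  qed
  have "r + 4 * j \<le> Q \<longleftrightarrow> j < (Q + 4 - r) div 4" for j Q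
    using r by (elim disjE) (simp_all, linarith+)
  then have j: "r + 4 * j \<le> M div d \<longleftrightarrow> j < L" for j
    unfolding L_def .
  have le: "d * k \<le> M \<longleftrightarrow> k \<le> M div d" for k
    using d0 by (simp add: less_eq_div_iff_mult_less_eq mult.commute)
  have "(\<Sum>n | n \<in> {1..M} \<and> n mod 4 = 1 \<and> d dvd n. expi (real n * sqrt 2))
      = (\<Sum>j<L. expi (real (d * (r + 4 * j)) * sqrt 2))"
  proof (rule sum.reindex_bij_witness[of _ "\<lambda>j. d * (r + 4 * j)" "\<lambda>n. n div d div 4"])
    fix n assume n: "n \<in> {n. n \<in> {1..M} \<and> n mod 4 = 1 \<and> d dvd n}"
    then obtain k where k: "n = d * k" by blast
    then have kr: "k mod 4 = r" using n dk by auto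
    then have k4: "r + 4 * (k div 4) = k" by presburger
    then show "d * (r + 4 * (n div d div 4)) = n" using k d0 by simp
    have "k \<le> M div d" using n k le by auto
    then show "n div d div 4 \<in> {..<L}" using k d0 k4 j[of "k div 4"] by simp
    show "expi (real (d * (r + 4 * (n div d div 4))) * sqrt 2) = expi (real n * sqrt 2)"
      using k d0 k4 by simp
  next
    fix i assume "i \<in> {..<L}"
    then have "d * (r + 4 * i) \<le> M" using j le by simp
    moreover have "d * (r + 4 * i) mod 4 = 1" unfolding dk using r by auto
    ultimately show "d * (r + 4 * i) \<in> {n. n \<in> {1..M} \<and> n mod 4 = 1 \<and> d dvd n}"
      using d0 r by auto
    show "d * (r + 4 * i) div d div 4 = i" using d0 r by auto
  qed
  also have "\<dots> = expi (real (d * r) * sqrt 2) * (\<Sum>j<L. expi (real j * (real (4 * d) * sqrt 2)))"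
    by (simp add: sum_distrib_left expi_add[symmetric] algebra_simps)
  finally have eq: "norm (\<Sum>n | n \<in> {1..M} \<and> n mod 4 = 1 \<and> d dvd n. expi (real n * sqrt 2))
      = norm (\<Sum>j<L. expi (real j * (real (4 * d) * sqrt 2)))" by (simp add: norm_mult)
  have ge: "1 / (4 * real (4 * d)) \<le> dist_int (real (4 * d) * sqrt 2)"
    using d0 by (intro dist_int_mult_sqrt2_ge) simp
  then have pos: "0 < dist_int (real (4 * d) * sqrt 2)"
    using d0 by (smt (verit) divide_pos_pos of_nat_0_less_iff mult_pos_pos zero_less_numeral)
  have "norm (\<Sum>j<L. expi (real j * (real (4 * d) * sqrt 2))) \<le> 1 / dist_int (real (4 * d) * sqrt 2)"
    by (rule norm_geometric_expi_le[OF pos])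
  also have "\<dots> \<le> 1 / (1 / (4 * real (4 * d)))"
    using ge pos d0 by (intro divide_left_mono) auto
  finally show ?thesis unfolding eq by simp
qed

subsection \<open>The sieve identity\<close>

definition sieve_divisors :: "nat \<Rightarrow> nat set" where
  "sieve_divisors z = {d. squarefree d \<and> (\<forall>p. prime p \<longrightarrow> p dvd d \<longrightarrow> prime3 p \<and> p \<le> z)}"

text \<open>On squarefree \<open>d\<close> this is the Moebius function.\<close>

definition sign_omega :: "nat \<Rightarrow> complex" where
  "sign_omega d = (- 1) ^ card (prime_factors d)"

text \<open>At \<open>d = 1\<close> this is a minimum over the empty set, hence unspecified.\<close>

definition least_prime :: "nat \<Rightarrow> nat" where
  "least_prime d = Min (prime_factors d)"

lemma norm_sign_omega [simp]: "norm (sign_omega d) = 1"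
  by (simp add: sign_omega_def norm_power)

lemma sign_omega_mult_prime:
  assumes "prime q" "\<not> q dvd d" "d > 0"
  shows "sign_omega (q * d) = - sign_omega d"
proof -
  have "prime_factors (q * d) = insert q (prime_factors d)"
    using assms by (subst prime_factors_product) (auto simp: prime_prime_factors)
  moreover have "q \<notin> prime_factors d" using assms by auto
  ultimately show ?thesis by (simp add: sign_omega_def)
qed

lemma least_prime_props:
  assumes "d > 1"
  shows "prime (least_prime d)" "least_prime d dvd d"
    "\<And>p. prime p \<Longrightarrow> p dvd d \<Longrightarrow> least_prime d \<le> p"
proof -
  obtain p where "prime p" "p dvd d" using assms prime_factor_nat[of d] by auto
  then have "prime_factors d \<noteq> {}" using assms by (auto simp: prime_factors_dvd)
  then have "least_prime d \<in> prime_factors d"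
    unfolding least_prime_def by (intro Min_in) auto
  then show "prime (least_prime d)" "least_prime d dvd d" by auto
  show "least_prime d \<le> p" if "prime p" "p dvd d" for p
    unfolding least_prime_def using that assms by (intro Min_le) (auto simp: prime_factors_dvd)
qed

lemma sieve_divisors_pos: "d \<in> sieve_divisors z \<Longrightarrow> d > 0"
  by (cases d) (auto simp: sieve_divisors_def)

lemma sieve_divisors_odd: "d \<in> sieve_divisors z \<Longrightarrow> odd d"
  unfolding sieve_divisors_def prime3_def by (auto dest: spec[of _ 2])

text \<open>Let \<open>q\<close> be the least admissible prime dividing \<open>n\<close>. Pairing \<open>d\<close> with \<open>q * d\<close> cancels
  everything in the first sum except the \<open>d\<close> with \<open>d \<le> y < q * d\<close>, and these are cancelled by
  the second sum, whose elements are exactly the corresponding \<open>q * d\<close>.\<close>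

lemma truncated_buchstab:
  fixes y :: real
  assumes n: "n > 0" and y: "y \<ge> 1"
  shows "of_bool (\<forall>p\<le>z. prime3 p \<longrightarrow> \<not> p dvd n) =
    (\<Sum>d | d \<in> sieve_divisors z \<and> d dvd n \<and> d \<le> y. sign_omega d) +
    (\<Sum>d | d \<in> sieve_divisors z \<and> d dvd n \<and> y < d \<and> d \<le> y * least_prime d
        \<and> (\<forall>p<least_prime d. prime3 p \<longrightarrow> \<not> p dvd n). sign_omega d)"
proof -
  define S where "S = {d \<in> sieve_divisors z. d dvd n}"
  define f where "f d = of_bool (real d \<le> y) * sign_omega d" for d
  define g where "g d = of_bool (y < d \<and> d \<le> y * least_prime d
        \<and> (\<forall>p<least_prime d. prime3 p \<longrightarrow> \<not> p dvd n)) * sign_omega d" for d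
  have fin: "finite S" using n by (auto simp: S_def)
  have "(\<Sum>d | d \<in> sieve_divisors z \<and> d dvd n \<and> d \<le> y. sign_omega d) = (\<Sum>d\<in>S. f d)"
    using fin by (intro sum.mono_neutral_cong_left) (auto simp: S_def f_def)
  moreover have "(\<Sum>d | d \<in> sieve_divisors z \<and> d dvd n \<and> y < d \<and> d \<le> y * least_prime d
        \<and> (\<forall>p<least_prime d. prime3 p \<longrightarrow> \<not> p dvd n). sign_omega d) = (\<Sum>d\<in>S. g d)"
    using fin by (intro sum.mono_neutral_cong_left) (auto simp: S_def g_def)
  moreover have "of_bool (\<forall>p\<le>z. prime3 p \<longrightarrow> \<not> p dvd n) = (\<Sum>d\<in>S. f d) + (\<Sum>d\<in>S. g d)"
  proof (cases "\<forall>p\<le>z. prime3 p \<longrightarrow> \<not> p dvd n")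
    case True
    have "d = 1" if d: "d \<in> S" for d
    proof (rule ccontr)
      assume "d \<noteq> 1"
      then obtain p where p: "prime p" "p dvd d" using prime_factor_nat by blast
      then have "prime3 p" "p \<le> z" "p dvd n"
        using d dvd_trans by (auto simp: S_def sieve_divisors_def)
      then show False using True by blast
    qed
    moreover have "1 \<in> S" by (auto simp: S_def sieve_divisors_def)
    ultimately have "S = {1}" by blast
    \<comment> \<open>At d = 1 the condition y < d fails, so the unspecified
      \<open>least_prime 1\<close> does no harm.\<close>
    then show ?thesis using True y by (simp add: f_def g_def sign_omega_def)
  next
    case False
    define q where "q = (LEAST p. p \<le> z \<and> prime3 p \<and> p dvd n)"
    have q: "q \<le> z" "prime3 q" "q dvd n"
      using False LeastI_ex[of "\<lambda>p. p \<le> z \<and> prime3 p \<and> p dvd n"] unfolding q_def by blast+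
    have q_min: "q \<le> p" if "p \<le> z" "prime3 p" "p dvd n" for p
      unfolding q_def using that by (intro Least_le) blast
    have pq: "prime q" using q by (simp add: prime3_def)
    define T where "T = {d \<in> S. \<not> q dvd d}"
    have T: "d \<in> sieve_divisors z" "d dvd n" "\<not> q dvd d" "d > 0" if "d \<in> T" for d
      using that sieve_divisors_pos by (auto simp: T_def S_def)
    have S_min: "q \<le> p" if "d \<in> S" "prime p" "p dvd d" for d p
      using that q_min dvd_trans by (auto simp: S_def sieve_divisors_def)
    have qT: "q * d \<in> S" if d: "d \<in> T" for d
    proof -
      have cop: "coprime q d" using T[OF d] pq prime_imp_coprime by blast
      then have "squarefree (q * d)"
        using T(1)[OF d] squarefree_prime[OF pq]
        by (intro squarefree_mult_coprime) (auto simp: sieve_divisors_def)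
      moreover have "q * d dvd n" using cop q T[OF d] divides_mult by blast
      moreover have "prime3 p \<and> p \<le> z" if "prime p" "p dvd q * d" for p
      proof -
        have "p dvd q \<or> p dvd d" using that prime_dvd_mult_iff by blast
        then show ?thesis
          using that T(1)[OF d] q pq primes_dvd_imp_eq[of p q] by (auto simp: sieve_divisors_def)
      qed
      ultimately show ?thesis by (auto simp: S_def sieve_divisors_def)
    qed
    have S_eq: "S = T \<union> (*) q ` T"
    proof
      show "T \<union> (*) q ` T \<subseteq> S" using qT by (auto simp: T_def)
      show "S \<subseteq> T \<union> (*) q ` T"
      proof
        fix d assume d: "d \<in> S"
        show "d \<in> T \<union> (*) q ` T"
        proof (cases "q dvd d")
          case True
          then obtain m where m: "d = q * m" by blast
          have sf: "squarefree d" using d by (simp add: S_def sieve_divisors_def)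
          have "\<not> q dvd m"
          proof
            assume "q dvd m"
            then have "q\<^sup>2 dvd d" unfolding m power2_eq_square by simp
            then show False using sf pq squarefreeD not_prime_unit by blast
          qed
          moreover have "m \<in> S"
            using d m squarefree_mono[of m d] dvd_trans[of m d n] by (auto simp: S_def sieve_divisors_def)
          ultimately show ?thesis using m by (auto simp: T_def)
        qed (use d in \<open>auto simp: T_def\<close>)
      qed
    qed
    have "(\<Sum>d\<in>S. f d) + (\<Sum>d\<in>S. g d) = (\<Sum>d\<in>S. f d + g d)"
      by (simp add: sum.distrib)
    also have "\<dots> = (\<Sum>d\<in>T. f d + g d) + (\<Sum>d\<in>(*) q ` T. f d + g d)"
      unfolding S_eq using fin by (intro sum.union_disjoint) (auto simp: T_def)
    also have "(\<Sum>d\<in>(*) q ` T. f d + g d) = (\<Sum>d\<in>T. f (q * d) + g (q * d))"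
      using pq by (subst sum.reindex) (auto simp: inj_on_def)
    also have "(\<Sum>d\<in>T. f d + g d) + (\<Sum>d\<in>T. f (q * d) + g (q * d)) = (\<Sum>d\<in>T. f d + g d + (f (q * d) + g (q * d)))"
      by (simp add: sum.distrib)
    also have "\<dots> = 0"
    proof (rule sum.neutral, rule ballI)
      fix d assume d: "d \<in> T"
      note dT = T[OF d]
      have dS: "d \<in> S" using d by (simp add: T_def)
      \<comment> \<open>All primes of \<open>d\<close> exceed \<open>q\<close>, while
        \<open>q\<close> itself divides \<open>n\<close>, so the side condition of the second sum
        fails.\<close>
      have "g d = 0"
      proof (cases "d = 1")
        case True
        then show ?thesis using y by (simp add: g_def)
      next
        case False
        then have d1: "d > 1" using dT by simp
        have "q \<le> least_prime d" using S_min[OF dS] least_prime_props[OF d1] by blast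
        moreover have "q \<noteq> least_prime d" using dT least_prime_props[OF d1] by auto
        ultimately have "q < least_prime d" by simp
        then show ?thesis using q by (auto simp: g_def)
      qed
      have qd1: "q * d > 1" using dT(4) prime_gt_1_nat[OF pq]
        by (metis One_nat_def Suc_leI less_le_trans mult.right_neutral mult_le_mono2)
      have lq: "least_prime (q * d) = q"
        using least_prime_props[OF qd1] S_min[OF qT[OF d]] pq by (intro antisym) auto
      have none: "\<forall>p<q. prime3 p \<longrightarrow> \<not> p dvd n" using q_min q by (meson le_trans less_le_not_le nat_le_linear)
      have "real (q * d) \<le> y * real q \<longleftrightarrow> real d \<le> y"
        using prime_gt_0_nat[OF pq] by (simp add: mult.commute)
      then have gq: "g (q * d) = - of_bool (y < real (q * d) \<and> real d \<le> y) * sign_omega d"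
        using sign_omega_mult_prime[OF pq dT(3,4)] none by (simp add: g_def lq)
      have fq: "f (q * d) = - of_bool (real (q * d) \<le> y) * sign_omega d"
        using sign_omega_mult_prime[OF pq dT(3,4)] by (simp add: f_def)
      have "real d \<le> real (q * d)" using prime_gt_0_nat[OF pq] by (simp only: of_nat_le_iff) simp
      then have "real (q * d) \<le> y \<Longrightarrow> real d \<le> y" by linarith
      \<comment> \<open>If q d <= y the two \<open>f\<close> terms cancel; if d <= y < q d, then
        \<open>f d\<close> cancels \<open>g (q * d)\<close>; if y < d all terms vanish.\<close>
      then show "f d + g d + (f (q * d) + g (q * d)) = 0"
        unfolding \<open>g d = 0\<close> gq fq unfolding f_def by (auto simp del: of_nat_mult)
    qed
    finally show ?thesis using False by simp
  qed
  ultimately show ?thesis by simp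
qed

text \<open>Write d = q m with \<open>q\<close> the least prime; then m <= y. If m = 1, d = q <= z.
  Otherwise \<open>q\<close> is at most any prime factor of \<open>m\<close>, so q <= m <= y as
  well.\<close>

lemma boundary_divisor_le:
  fixes y :: real
  assumes d: "d \<in> sieve_divisors z" and y: "1 \<le> y" "y < d" "d \<le> y * least_prime d" and z: "z \<le> y\<^sup>2"
  shows "d \<le> y\<^sup>2"
proof -
  have d1: "d > 1" using y by linarith
  note l = least_prime_props[OF d1]
  define q where "q = least_prime d"
  obtain m where m: "d = q * m" using l(2) unfolding q_def by blast
  have q0: "q > 0" using l(1) prime_gt_0_nat unfolding q_def by blast
  have "real q * real m \<le> y * real q"
    using y(3) unfolding q_def[symmetric] by (simp add: m)
  then have my: "real m \<le> y" using q0 by (simp add: mult.commute)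
  show ?thesis
  proof (cases "m = 1")
    case True
    have "q \<le> z" using d l(1,2) unfolding q_def sieve_divisors_def by blast
    then have "d \<le> z" using m True by simp
    then show ?thesis using z by linarith
  next
    case False
    then obtain p where p: "prime p" "p dvd m" using prime_factor_nat by blast
    have "m > 0" using m d1 by (cases m) auto
    then have "p \<le> m" using p by (simp add: dvd_imp_le)
    moreover have "q \<le> p" unfolding q_def using p m by (intro l(3)) auto
    ultimately have "real q \<le> y" using my by linarith
    then have "real q * real m \<le> y * y" using my y by (intro mult_mono) auto
    then show ?thesis by (simp add: m power2_eq_square)
  qed
qed

lemma sum_dyadic:
  fixes F :: "nat \<Rightarrow> 'a :: comm_monoid_add"
  assumes "E \<subseteq> {1..<2 ^ J}"
  shows "(\<Sum>d\<in>E. F d) = (\<Sum>i<J. \<Sum>d\<in>E \<inter> {2 ^ i..<2 * 2 ^ i}. F d)"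
  using assms
proof (induction J arbitrary: E)
  case (Suc J)
  have fin: "finite E" using Suc.prems finite_subset by blast
  have "(\<Sum>d\<in>E. F d) = (\<Sum>d\<in>E \<inter> {1..<2 ^ J}. F d) + (\<Sum>d\<in>E \<inter> {2 ^ J..<2 * 2 ^ J}. F d)"
  proof (subst sum.union_disjoint[symmetric])
    show "sum F E = sum F (E \<inter> {1..<2 ^ J} \<union> E \<inter> {2 ^ J..<2 * 2 ^ J})"
      using Suc.prems by (intro arg_cong[where f = "sum F"]) (auto simp: not_le)
  qed (use fin in auto)
  also have "(\<Sum>d\<in>E \<inter> {1..<2 ^ J}. F d) = (\<Sum>i<J. \<Sum>d\<in>E \<inter> {1..<2 ^ J} \<inter> {2 ^ i..<2 * 2 ^ i}. F d)"
    by (rule Suc.IH) auto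
  also have "\<dots> = (\<Sum>i<J. \<Sum>d\<in>E \<inter> {2 ^ i..<2 * 2 ^ i}. F d)"
  proof (intro sum.cong refl)
    fix i assume "i \<in> {..<J}"
    then have "(2::nat) ^ Suc i \<le> 2 ^ J" by (intro power_increasing) auto
    moreover have "(1::nat) \<le> 2 ^ i" by simp
    ultimately have "{2 ^ i..<2 * 2 ^ i} \<subseteq> {1..<2 ^ J :: nat}"
      unfolding power_Suc by (intro subsetI) (auto dest: le_trans less_le_trans)
    then show "E \<inter> {1..<2 ^ J} \<inter> {2 ^ i..<2 * 2 ^ i} = E \<inter> {2 ^ i..<2 * 2 ^ i}" by blast
  qed
  finally show ?case by simp
qed simp

subsection \<open>The exponential sum\<close>

text \<open>The cutoff \<open>W\<close> is the value when no prime congruent to 3 modulo 4 below it divides \<open>k\<close>.\<close>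

definition least_prime3 :: "nat \<Rightarrow> nat \<Rightarrow> nat" where
  "least_prime3 W k = (LEAST p. (prime3 p \<and> p dvd k) \<or> p = W)"

lemma least_prime3_le: "least_prime3 W k \<le> W"
  unfolding least_prime3_def by (rule Least_le) simp

text \<open>Turns a divisibility condition into a comparison of a number depending on
  \<open>d\<close> with one depending on \<open>k\<close>, ready for separation by binary
  digits.\<close>

lemma le_least_prime3_iff:
  assumes "g \<le> W"
  shows "g \<le> least_prime3 W k \<longleftrightarrow> (\<forall>p<g. prime3 p \<longrightarrow> \<not> p dvd k)"
proof
  assume "g \<le> least_prime3 W k"
  then show "\<forall>p<g. prime3 p \<longrightarrow> \<not> p dvd k"
    unfolding least_prime3_def using not_less_Least less_le_trans by blast
next
  assume *: "\<forall>p<g. prime3 p \<longrightarrow> \<not> p dvd k"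
  have "(prime3 (least_prime3 W k) \<and> least_prime3 W k dvd k) \<or> least_prime3 W k = W"
    unfolding least_prime3_def by (rule LeastI[of _ W]) simp
  then show "g \<le> least_prime3 W k" using * assms by (metis not_le)
qed

lemma expsum_eq_sieve:
  assumes N: "N \<ge> 2"
  defines "M \<equiv> nat \<lfloor>N\<rfloor>" and "z \<equiv> nat \<lfloor>sqrt N\<rfloor>"
  shows "expsum (sqrt 2) N = (\<Sum>n | n \<in> {1..M} \<and> n mod 4 = 1.
    of_bool (\<forall>p\<le>z. prime3 p \<longrightarrow> \<not> p dvd n) * expi (real n * sqrt 2))"
proof -
  have set: "{n. 1 \<le> n \<and> real n \<le> N} = {1..M}"
    using N by (auto simp: M_def le_nat_iff le_floor_iff)
  have "p \<le> z" if "p\<^sup>2 \<le> M" for p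
  proof -
    have "real (p\<^sup>2) \<le> real M" using that by (simp only: of_nat_le_iff)
    also have "real M \<le> N" using N by (simp add: M_def)
    finally have "real (p\<^sup>2) \<le> N" .
    then have "real p \<le> sqrt N" by (simp add: real_le_rsqrt)
    then show ?thesis unfolding z_def by (rule le_nat_floor)
  qed
  then have iff: "n \<in> frakB \<longleftrightarrow> (\<forall>p\<le>z. prime3 p \<longrightarrow> \<not> p dvd n)" if "n \<le> M" "n mod 4 = 1" for n
    using frakB_iff_small[OF that] by blast
  show ?thesis
    unfolding expsum_def set
    by (rule sum.mono_neutral_cong_right) (auto simp: bchar_def iff indicator_def dest: frakB_mod_4)
qed

text \<open>After interchanging sums there are at most \<open>y\<close> divisors \<open>d\<close>,
  each contributing at most 16 d <= 16 y.\<close>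

lemma norm_type_I_le:
  fixes y :: real
  assumes "y \<ge> 0"
  shows "norm (\<Sum>n | n \<in> {1..M} \<and> n mod 4 = 1. (\<Sum>d | d \<in> sieve_divisors z \<and> d dvd n \<and> d \<le> y. sign_omega d)
      * expi (real n * sqrt 2)) \<le> 16 * y\<^sup>2"
proof -
  define X where "X = {n. n \<in> {1..M} \<and> n mod 4 = 1}"
  define E where "E = {d \<in> sieve_divisors z. d \<le> y}"
  have "d \<in> {1..nat \<lfloor>y\<rfloor>}" if "d \<in> E" for d
    using that sieve_divisors_pos[of d z] by (auto simp: E_def le_nat_iff le_floor_iff Suc_le_eq)
  then have E_sub: "E \<subseteq> {1..nat \<lfloor>y\<rfloor>}" by blast
  then have finE: "finite E" using finite_subset by blast
  have "card E \<le> nat \<lfloor>y\<rfloor>" using card_mono[OF _ E_sub] by simp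
  also have "real (nat \<lfloor>y\<rfloor>) \<le> y" using assms by simp
  finally have cE: "card E \<le> y" by simp
  have finX: "finite X" by (simp add: X_def)
  have "(\<Sum>n\<in>X. (\<Sum>d | d \<in> sieve_divisors z \<and> d dvd n \<and> d \<le> y. sign_omega d) * expi (real n * sqrt 2))
      = (\<Sum>n\<in>X. \<Sum>d\<in>E. if d dvd n then sign_omega d * expi (real n * sqrt 2) else 0)"
  proof (rule sum.cong[OF refl])
    fix n
    have "{d. d \<in> sieve_divisors z \<and> d dvd n \<and> d \<le> y} = {d \<in> E. d dvd n}" by (auto simp: E_def)
    then show "(\<Sum>d | d \<in> sieve_divisors z \<and> d dvd n \<and> d \<le> y. sign_omega d) * expi (real n * sqrt 2)
        = (\<Sum>d\<in>E. if d dvd n then sign_omega d * expi (real n * sqrt 2) else 0)"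
      using finE by (simp add: sum_distrib_right sum.inter_filter if_distrib[of "\<lambda>x. x * _"] cong: if_cong)
  qed
  also have "\<dots> = (\<Sum>d\<in>E. \<Sum>n\<in>X. if d dvd n then sign_omega d * expi (real n * sqrt 2) else 0)"
    by (rule sum.swap)
  also have "\<dots> = (\<Sum>d\<in>E. sign_omega d * (\<Sum>n | n \<in> {1..M} \<and> n mod 4 = 1 \<and> d dvd n. expi (real n * sqrt 2)))"
  proof (rule sum.cong[OF refl])
    fix d
    have "{n. n \<in> {1..M} \<and> n mod 4 = 1 \<and> d dvd n} = {n \<in> X. d dvd n}" by (auto simp: X_def)
    then show "(\<Sum>n\<in>X. if d dvd n then sign_omega d * expi (real n * sqrt 2) else 0)
        = sign_omega d * (\<Sum>n | n \<in> {1..M} \<and> n mod 4 = 1 \<and> d dvd n. expi (real n * sqrt 2))"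
      using finX by (simp add: sum_distrib_left sum.inter_filter if_distrib[of "\<lambda>x. _ * x"] cong: if_cong)
  qed
  also have "norm \<dots> \<le> (\<Sum>d\<in>E. 16 * y)"
  proof (rule sum_norm_le)
    fix d assume d: "d \<in> E"
    have "norm (sign_omega d * (\<Sum>n | n \<in> {1..M} \<and> n mod 4 = 1 \<and> d dvd n. expi (real n * sqrt 2))) \<le> 16 * real d"
      using norm_sum_progression_le[OF sieve_divisors_odd[of d z]] d by (simp add: norm_mult E_def)
    then show "norm (sign_omega d * (\<Sum>n | n \<in> {1..M} \<and> n mod 4 = 1 \<and> d dvd n. expi (real n * sqrt 2))) \<le> 16 * y"
      using d by (auto simp: E_def)
  qed
  also have "\<dots> = 16 * (card E * y)" by simp
  also have "\<dots> \<le> 16 * (y * y)" using cE assms by (intro mult_left_mono mult_right_mono) auto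
  finally show ?thesis by (simp add: X_def power2_eq_square)
qed

lemma sum_over_multiples:
  fixes F :: "nat \<Rightarrow> complex"
  assumes "d > 0"
  shows "(\<Sum>n | n \<in> {1..M} \<and> d dvd n. F n) = (\<Sum>k=1..M div d. F (d * k))"
proof (rule sum.reindex_bij_witness[of _ "\<lambda>k. d * k" "\<lambda>n. n div d"])
  fix n assume n: "n \<in> {n. n \<in> {1..M} \<and> d dvd n}"
  then have "d * (n div d) = n" by simp
  then show "d * (n div d) = n" "F (d * (n div d)) = F n" by simp_all
  have "n div d \<noteq> 0" using n \<open>d * (n div d) = n\<close> by (cases "n div d") auto
  then show "n div d \<in> {1..M div d}" using n by (simp add: div_le_mono Suc_le_eq)
next
  fix k assume "k \<in> {1..M div d}"
  then show "d * k div d = k" "d * k \<in> {n. n \<in> {1..M} \<and> d dvd n}"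
    using assms by (auto simp: less_eq_div_iff_mult_less_eq mult.commute Suc_le_eq)
qed

text \<open>Put n = d k. Primes below the least prime of \<open>d\<close> do not divide
  \<open>d\<close>, so the sieve condition falls on \<open>k\<close>; as \<open>d\<close> is odd, n
  = 1 modulo 4 means d = k modulo 4. The \<open>Suc\<close> makes the comparison strict.\<close>

lemma type_II_eq_bilinear:
  fixes y :: real
  assumes zM: "z \<le> M" and y: "y \<ge> 1"
  defines "E \<equiv> {d \<in> sieve_divisors z. y < d \<and> d \<le> y * least_prime d}"
  assumes finE: "finite E"
  shows "(\<Sum>n | n \<in> {1..M} \<and> n mod 4 = 1. (\<Sum>d | d \<in> sieve_divisors z \<and> d dvd n \<and> y < d \<and> d \<le> y * least_prime d
        \<and> (\<forall>p<least_prime d. prime3 p \<longrightarrow> \<not> p dvd n). sign_omega d) * expi (real n * sqrt 2))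
    = (\<Sum>d\<in>E. \<Sum>k=1..M div d. of_bool (least_prime d < Suc (least_prime3 M k) \<and> d mod 4 = k mod 4)
        * sign_omega d * expi (real (d * k) * sqrt 2))"
proof -
  define X where "X = {n. n \<in> {1..M} \<and> n mod 4 = 1}"
  define Q where "Q d n \<longleftrightarrow> (\<forall>p<least_prime d. prime3 p \<longrightarrow> \<not> p dvd n)" for d n
  define e where "e n = expi (real n * sqrt 2)" for n
  have "(\<Sum>n\<in>X. (\<Sum>d | d \<in> sieve_divisors z \<and> d dvd n \<and> y < d \<and> d \<le> y * least_prime d \<and> Q d n. sign_omega d) * e n)
      = (\<Sum>n\<in>X. \<Sum>d\<in>E. if d dvd n \<and> Q d n then sign_omega d * e n else 0)"
  proof (rule sum.cong[OF refl])
    fix n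
    have "{d. d \<in> sieve_divisors z \<and> d dvd n \<and> y < d \<and> d \<le> y * least_prime d \<and> Q d n} = {d \<in> E. d dvd n \<and> Q d n}"
      by (auto simp: E_def)
    then show "(\<Sum>d | d \<in> sieve_divisors z \<and> d dvd n \<and> y < d \<and> d \<le> y * least_prime d \<and> Q d n. sign_omega d) * e n
        = (\<Sum>d\<in>E. if d dvd n \<and> Q d n then sign_omega d * e n else 0)"
      using finE by (simp add: sum_distrib_right sum.inter_filter if_distrib[of "\<lambda>x. x * _"] cong: if_cong)
  qed
  also have "\<dots> = (\<Sum>d\<in>E. \<Sum>n\<in>X. if d dvd n \<and> Q d n then sign_omega d * e n else 0)"
    by (rule sum.swap)
  also have "\<dots> = (\<Sum>d\<in>E. \<Sum>k=1..M div d. of_bool (least_prime d < Suc (least_prime3 M k) \<and> d mod 4 = k mod 4)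
        * sign_omega d * e (d * k))"
  proof (rule sum.cong[OF refl])
    fix d assume d: "d \<in> E"
    then have dD: "d \<in> sieve_divisors z" by (simp add: E_def)
    have "odd d" using sieve_divisors_odd[OF dD] .
    have d1: "d > 1" using d y by (auto simp: E_def)
    note l = least_prime_props[OF d1]
    have lM: "least_prime d \<le> M" using l dD zM by (auto simp: sieve_divisors_def)
    have mod4: "d * k mod 4 = 1 \<longleftrightarrow> d mod 4 = k mod 4" for k
    proof -
      have "d * k mod 4 = (d mod 4) * (k mod 4) mod 4" by (simp add: mod_mult_eq)
      moreover have "d mod 4 = 1 \<or> d mod 4 = 3" using \<open>odd d\<close> by presburger
      moreover have "k mod 4 \<in> {0, 1, 2, 3}" by auto
      ultimately show ?thesis by auto
    qed
    have Q: "Q d (d * k) \<longleftrightarrow> least_prime d < Suc (least_prime3 M k)" for k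
    proof -
      have "p dvd d * k \<longleftrightarrow> p dvd k" if "p < least_prime d" "prime3 p" for p
        using that l(3)[of p] prime_dvd_mult_iff[of p d k] by (auto simp: prime3_def)
      then show ?thesis
        using le_least_prime3_iff[OF lM, of k] by (auto simp: Q_def less_Suc_eq_le)
    qed
    have "(\<Sum>n\<in>X. if d dvd n \<and> Q d n then sign_omega d * e n else 0)
        = (\<Sum>n | n \<in> {1..M} \<and> d dvd n. of_bool (Q d n \<and> n mod 4 = 1) * sign_omega d * e n)"
      by (intro sum.mono_neutral_cong) (auto simp: X_def)
    also have "\<dots> = (\<Sum>k=1..M div d. of_bool (Q d (d * k) \<and> d * k mod 4 = 1) * sign_omega d * e (d * k))"
      using d1 by (intro sum_over_multiples) auto
    finally show "(\<Sum>n\<in>X. if d dvd n \<and> Q d n then sign_omega d * e n else 0)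
        = (\<Sum>k=1..M div d. of_bool (least_prime d < Suc (least_prime3 M k) \<and> d mod 4 = k mod 4) * sign_omega d * e (d * k))"
      by (simp only: Q mod4)
  qed
  finally show ?thesis by (simp add: X_def Q_def e_def)
qed

lemma sieve_const_le:
  fixes N y :: real
  assumes N: "N \<ge> 2" and M: "real M \<le> N" and y: "1 \<le> y" "y ^ 3 = N"
    and D: "y < 2 * real D" "real D \<le> y\<^sup>2"
  shows "M * sieve_const M D \<le> 81 * (N * y\<^sup>2 * ln N)"
proof -
  have D1: "real D \<ge> 1" using D y by (cases D) auto
  have L: "1 \<le> 2 * ln N"
  proof -
    have "ln 2 \<le> ln N" using N by simp
    then show ?thesis using ln2_ge_two_thirds by linarith
  qed
  have "real D \<le> N"
    using D y power_increasing[of 2 3 y] by linarith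
  then have "2 * real D \<le> N * N" using N D1 by (intro mult_mono) auto
  then have "ln (2 * real D) \<le> ln (N * N)" using D1 N by (subst ln_le_cancel_iff) auto
  then have lnD: "ln (2 * real D) \<le> 2 * ln N" using N by (simp add: ln_mult)
  have "real M / real D \<le> N / (y / 2)"
    using M D y D1 N by (intro frac_le) auto
  also have "\<dots> = 2 * y\<^sup>2"
    using y(1) by (simp add: y(2)[symmetric] power2_eq_square power3_eq_cube)
  also have "\<dots> \<le> (2 * y\<^sup>2) * (2 * ln N)"
    using L mult_left_mono[of 1 "2 * ln N" "2 * y\<^sup>2"] by simp
  finally have 1: "real M / real D \<le> 4 * (y\<^sup>2 * ln N)" by simp
  have "16 * real D * (ln (2 * real D) + 1) \<le> 16 * y\<^sup>2 * (2 * ln N + 2 * ln N)"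
    using D lnD L D1 by (intro mult_mono add_mono) auto
  with 1 have "sieve_const M D \<le> 68 * (y\<^sup>2 * ln N)"
    unfolding sieve_const_def by argo
  \<comment> \<open>68 = 4 + 64 is rounded up to a square, because a root is taken later.\<close>
  also have "\<dots> \<le> 81 * (y\<^sup>2 * ln N)" using L by (intro mult_right_mono) auto
  finally have "M * sieve_const M D \<le> N * (81 * (y\<^sup>2 * ln N))"
    using M N L D1 lnD by (intro mult_mono) (auto simp: sieve_const_def intro!: add_nonneg_nonneg)
  then show ?thesis by (simp add: mult_ac)
qed

section \<open>Combination of the linear and bilinear estimates\<close>

theorem theorem1p7:
  "\<exists>C>0. \<forall>N\<ge>(2::real). norm (expsum (sqrt 2) N) \<le> C * N powr (5/6) * ln N powr (13/2)"
proof -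
  have bound: "norm (expsum (sqrt 2) N) \<le> 10000 * N powr (5/6) * ln N powr (13/2)" if N: "N \<ge> 2" for N :: real
  proof -
    define M where "M = nat \<lfloor>N\<rfloor>"
    define z where "z = nat \<lfloor>sqrt N\<rfloor>"
    \<comment> \<open>The choice balances N/D at D = y against D at D = y^2: both are N^(2/3), and
      the root of N times this is N^(5/6).\<close>
    define y where "y = N powr (1/3)"
    define L where "L = ln N"
    define E where "E = {d \<in> sieve_divisors z. y < d \<and> d \<le> y * least_prime d}"
    have L: "1 / 2 \<le> L"
    proof -
      have "ln 2 \<le> ln N" using N by simp
      then show ?thesis using ln2_ge_two_thirds unfolding L_def by linarith
    qed
    have y1: "1 \<le> y" using N by (simp add: y_def ge_one_powr_ge_zero)
    have y3: "y ^ 3 = N" using N by (simp add: y_def powr_power)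
    have y2: "y\<^sup>2 = N powr (2/3)" using N by (simp add: y_def powr_power)
    have MN: "real M \<le> N" using N by (simp add: M_def)
    have zy: "real z \<le> y\<^sup>2"
    proof -
      have "real z \<le> sqrt N" using N by (simp add: z_def)
      also have "\<dots> = N powr (1/2)" using N by (simp add: powr_half_sqrt)
      also have "\<dots> \<le> N powr (2/3)" using N by (intro powr_mono) auto
      finally show ?thesis by (simp add: y2)
    qed
    have y2N: "y\<^sup>2 \<le> N" using y1 y3 power_increasing[of 2 3 y] by simp
    have zM: "z \<le> M"
    proof -
      have "sqrt N \<le> N" using N by (intro real_le_lsqrt) (auto simp: power2_eq_square)
      then show ?thesis unfolding z_def M_def by (intro nat_mono floor_mono)
    qed
    have E_le: "real d \<le> y\<^sup>2" if "d \<in> E" for d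
      using that boundary_divisor_le[of d z y] y1 zy by (auto simp: E_def)
    \<comment> \<open>The power 2^J has to exceed the divisors in \<open>E\<close>, at most
      \<open>M\<close>, and also \<open>Suc (least_prime3 M k)\<close>, at most M + 1.\<close>
    obtain i where i: "2 ^ i \<le> M + 2" "M + 2 < 2 ^ (i + 1)"
      using ex_power_ivl1[of 2 "M + 2"] by auto
    define J where "J = i + 1"
    have J: "M + 2 < 2 ^ J" using i by (simp add: J_def)
    have J_le: "real J \<le> 6 * L"
    proof -
      have "(2::real) ^ J = 2 * real (2 ^ i)" by (simp add: J_def)
      also have "\<dots> \<le> 2 * real (M + 2)" using i by (intro mult_left_mono) (simp_all only: of_nat_le_iff)
      also have "\<dots> \<le> 2 * (2 * N)" using MN N by simp
      also have "\<dots> \<le> N * (N * N)" using N by (intro mult_mono) auto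
      finally have "ln ((2::real) ^ J) \<le> ln (N * (N * N))" using N by (subst ln_le_cancel_iff) auto
      then have "real J * ln 2 \<le> 3 * L" using N by (simp add: ln_realpow ln_mult L_def)
      moreover have "real J * (1/2) \<le> real J * ln 2"
        using ln2_ge_two_thirds by (intro mult_left_mono) auto
      ultimately show ?thesis by linarith
    qed
    have E_sub: "E \<subseteq> {1..<2 ^ J}"
    proof
      fix d assume d: "d \<in> E"
      have "real d \<le> N" using E_le[OF d] y2N by linarith
      then have "d \<le> M" by (simp add: M_def le_nat_iff le_floor_iff)
      moreover have "d > 0" using d sieve_divisors_pos by (auto simp: E_def)
      ultimately show "d \<in> {1..<2 ^ J}" using J by simp
    qed
    then have finE: "finite E" using finite_subset by blast
    define T1 where "T1 = (\<Sum>n | n \<in> {1..M} \<and> n mod 4 = 1.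
      (\<Sum>d | d \<in> sieve_divisors z \<and> d dvd n \<and> d \<le> y. sign_omega d) * expi (real n * sqrt 2))"
    define T2 where "T2 = (\<Sum>n | n \<in> {1..M} \<and> n mod 4 = 1.
      (\<Sum>d | d \<in> sieve_divisors z \<and> d dvd n \<and> y < d \<and> d \<le> y * least_prime d
        \<and> (\<forall>p<least_prime d. prime3 p \<longrightarrow> \<not> p dvd n). sign_omega d) * expi (real n * sqrt 2))"
    define F where "F d = (\<Sum>k=1..M div d. of_bool (least_prime d < Suc (least_prime3 M k) \<and> d mod 4 = k mod 4)
        * sign_omega d * expi (real (d * k) * sqrt 2))" for d
    have "norm (expsum (sqrt 2) N) = norm (T1 + T2)"
      unfolding expsum_eq_sieve[OF N] T1_def T2_def M_def[symmetric] z_def[symmetric] sum.distrib[symmetric]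
      using truncated_buchstab[OF _ y1] by (intro arg_cong[of _ _ norm] sum.cong refl) (simp add: distrib_right)
    moreover have "norm T1 \<le> 16 * y\<^sup>2"
      unfolding T1_def using y1 by (intro norm_type_I_le) simp
    moreover have "norm T2 \<le> 324 * (N powr (5/6) * L powr (5/2))"
    proof -
      have "T2 = (\<Sum>d\<in>E. F d)"
        unfolding T2_def F_def E_def using finE
        by (intro type_II_eq_bilinear zM y1) (simp add: E_def)
      also have "\<dots> = (\<Sum>i<J. \<Sum>d\<in>E \<inter> {2 ^ i..<2 * 2 ^ i}. F d)"
        by (rule sum_dyadic[OF E_sub])
      also have "norm \<dots> \<le> (\<Sum>i<J. J * (9 * (N powr (5/6) * L powr (1/2))))"
      proof (rule sum_norm_le)
        fix i
        define D where "D = (2::nat) ^ i"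
        have "norm (\<Sum>d\<in>E \<inter> {D..<2 * D}. F d) \<le> J * (9 * (N powr (5/6) * L powr (1/2)))"
        proof (cases "E \<inter> {D..<2 * D} = {}")
          case True
          then show ?thesis using L N by simp
        next
          case False
          \<comment> \<open>An element of the block is what places D between y/2 and y^2, so empty
            blocks were treated apart.\<close>
          then obtain d where d: "d \<in> E" "D \<le> d" "d < 2 * D" by auto
          have "real d < 2 * real D" using d(3) by linarith
          then have "y < 2 * real D" using d(1) by (simp add: E_def)
          moreover have "real D \<le> y\<^sup>2" using d E_le[of d] by linarith
          ultimately have sc: "M * sieve_const M D \<le> 81 * (N * y\<^sup>2 * L)"
            unfolding L_def by (intro sieve_const_le[OF N MN y1 y3])
          have "norm (\<Sum>d\<in>E \<inter> {D..<2 * D}. F d) \<le> J * sqrt (M * sieve_const M D)"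
            unfolding F_def
          proof (rule norm_bilinear_expi_le)
            show "D > 0" by (simp add: D_def)
            show "Suc (least_prime3 M k) < 2 ^ J" for k
              using least_prime3_le[of M k] J by linarith
            show "least_prime d < 2 ^ J" if "d \<in> E \<inter> {D..<2 * D}" for d
            proof -
              have dE: "d \<in> E" using that by simp
              then have "d > 1" using y1 by (auto simp: E_def)
              then have "least_prime d \<le> z"
                using dE least_prime_props[of d] by (auto simp: E_def sieve_divisors_def)
              then show ?thesis using zM J by linarith
            qed
          qed auto
          also have "\<dots> \<le> J * sqrt (81 * (N * y\<^sup>2 * L))"
            using sc by (intro mult_left_mono real_sqrt_le_mono) auto
          also have "sqrt (81 * (N * y\<^sup>2 * L)) = 9 * (N powr (5/6) * L powr (1/2))"
          proof (rule real_sqrt_unique)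
            have "(N powr (5/6))\<^sup>2 = N powr (1 + 2/3)" using N by (simp add: powr_power)
            also have "\<dots> = N * y\<^sup>2" using N unfolding powr_add y2 by simp
            finally have "(N powr (5/6))\<^sup>2 = N * y\<^sup>2" .
            moreover have "(L powr (1/2))\<^sup>2 = L" using L by (simp add: powr_power)
            ultimately show "(9 * (N powr (5/6) * L powr (1/2)))\<^sup>2 = 81 * (N * y\<^sup>2 * L)"
              by (simp add: power_mult_distrib)
          qed simp
          finally show ?thesis .
        qed
        then show "norm (\<Sum>d\<in>E \<inter> {2 ^ i..<2 * 2 ^ i}. F d) \<le> J * (9 * (N powr (5/6) * L powr (1/2)))"
          by (simp add: D_def)
      qed
      \<comment> \<open>One factor J counts dyadic blocks, the other binary digits; 36 * 9 =
        324.\<close>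
      also have "\<dots> = (real J * real J) * (9 * (N powr (5/6) * L powr (1/2)))" by simp
      also have "\<dots> \<le> (6 * L * (6 * L)) * (9 * (N powr (5/6) * L powr (1/2)))"
        using J_le L by (intro mult_right_mono mult_mono) auto
      also have "\<dots> = 324 * (N powr (5/6) * (L powr 2 * L powr (1/2)))"
        using L by (simp add: power2_eq_square)
      also have "L powr 2 * L powr (1/2) = L powr (5/2)" by (simp flip: powr_add)
      finally show ?thesis .
    qed
    \<comment> \<open>Here ln N may be below 1, so powers of it are compared through L >= 1/2 at the
      price of a constant.\<close>
    moreover have "y\<^sup>2 \<le> 8 * (N powr (5/6) * L powr (5/2))"
    proof -
      have "(1/8 :: real) = (1/2) powr 3" by (simp add: power3_eq_cube)
      also have "\<dots> \<le> (1/2) powr (5/2)" by (rule powr_mono') auto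
      also have "\<dots> \<le> L powr (5/2)" using L by (intro powr_mono2) auto
      finally have "1 \<le> 8 * L powr (5/2)" by simp
      moreover have "y\<^sup>2 \<le> N powr (5/6)" unfolding y2 using N by (intro powr_mono) auto
      ultimately have "y\<^sup>2 * 1 \<le> N powr (5/6) * (8 * L powr (5/2))" by (intro mult_mono) auto
      then show ?thesis by simp
    qed
    moreover have "L powr (5/2) \<le> 16 * L powr (13/2)"
    proof -
      have "(1/16 :: real) = (1/2) powr 4" by (simp add: power4_eq_xxxx)
      also have "\<dots> \<le> L powr 4" using L by (intro powr_mono2) auto
      finally have "1 \<le> 16 * L powr 4" by simp
      then have "L powr (5/2) * 1 \<le> L powr (5/2) * (16 * L powr 4)" by (intro mult_left_mono) auto
      also have "\<dots> = 16 * L powr (5/2 + 4)" by (simp only: powr_add mult_ac)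
      finally show ?thesis by simp
    qed
    then have "N powr (5/6) * L powr (5/2) \<le> 16 * (N powr (5/6) * L powr (13/2))"
      using mult_left_mono[of "L powr (5/2)" "16 * L powr (13/2)" "N powr (5/6)"] by simp
    moreover have "norm (T1 + T2) \<le> norm T1 + norm T2" by (rule norm_triangle_ineq)
    moreover have "0 \<le> N powr (5/6) * L powr (13/2)" by simp
    \<comment> \<open>The constants give (16 * 8 + 324) * 16 = 7232.\<close>
    ultimately have "norm (expsum (sqrt 2) N) \<le> 10000 * (N powr (5/6) * L powr (13/2))"
      by linarith
    then show ?thesis by (simp add: L_def mult.assoc)
  qed
  show ?thesis using bound by (intro exI[of _ 10000]) simp
qed

end
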